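(* Let $k\le n$ be positive integers and $\lambda\in\mathcal{SP}_n$ a strict partition of $n$. Then $$g^*_{k}Q_{\lambda}.1=\sum_{\mu\subset\lambda,\ \mu\in\mathcal{SP}_{n-k}}2^{-l(\mu)}(-1)^{n-k}\,\mathrm{Pf}(M(\lambda/\mu))\,Q_{\mu}.1 .$$
   Context: $\mathcal{SP}_m$ is the set of strict partitions of $m$; $l(\mu)$ is the number of nonzero parts; $\mu\subset\lambda$ means $\mu_i\le\lambda_i$ for all $i$; $z_\lambda=\prod_{i\ge1}i^{m_i}m_i!$, $m_i$ the multiplicity of $i$ in $\lambda$. Ring and operators: $\Gamma=\mathbb{Q}(t)[p_1,p_3,p_5,\dots]$ is generated by the odd power sums, with the bilinear form $\langle p_\lambda,p_\mu\rangle=2^{-l(\lambda)}z_\lambda\delta_{\lambda\mu}$ for partitions $\lambda,\mu$ with all parts odd. Operators $Q_n$ ($n\in\mathbb Z$) on $\Gamma$ are defined by $\sum_{n}Q_nz^n=\exp\big(\sum_{n\ge1,\,\mathrm{odd}}\frac2n p_nz^n\big)\exp\big(-\sum_{n\ge1,\,\mathrm{odd}}\frac{\partial}{\partial p_n}z^{-n}\big)$, and $Q_\lambda.1=Q_{\lambda_1}\cdots Q_{\lambda_l}.1$ for $\lambda=(\lambda_1,\dots,\lambda_l)$ (Schur's $Q$-function when $\lambda$ is strict). The operator $g_n^*$ is the adjoint of multiplication by $g_n$, where $\sum_{n\ge0}g_nz^n=\exp\big(\sum_{n\ge1,\,\mathrm{odd}}\frac{2(t^n-1)}{n}p_nz^n\big)$;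 explicitly $\sum_{n\ge0}g_n^*z^{-n}=\exp\big(\sum_{n\ge1,\,\mathrm{odd}}(t^n-1)\frac{\partial}{\partial p_n}z^{-n}\big)$. Polynomials: $f_0=1$, $f_i=2(t-1)\frac{t^i-(-1)^i}{t+1}$ for $i\ge1$, $f_i=0$ for $i<0$. For $m\ge0$, $f_{(m,0)}=f_m$, and for $n>0$, $f_{(m,n)}=f_mf_n+2\sum_{a=1}^n(-1)^af_{m+a}f_{n-a}$. The matrix: write $\lambda=(\lambda_1,\dots,\lambda_s)$ with $s=l(\lambda)$ and $\mu=(\mu_1,\dots,\mu_r)$ with $r=l(\mu)$ if $l(\lambda)+l(\mu)$ is even, and $r=l(\mu)+1$, $\mu_r=0$, if $l(\lambda)+l(\mu)$ is odd; so $r+s$ is even. $M(\lambda/\mu)$ is the $(r+s)\times(r+s)$ antisymmetric matrix in block form $$\begin{pmatrix}0_{r\times r}&B\\-B^{\top}&D\end{pmatrix},$$ where $B$ is $r\times s$ with $B_{ij}=f_{\lambda_j}$ if $i=1$ and $\mu_r=0$, and $B_{ij}=2(-1)^{\mu_{r-i+1}}f_{\lambda_j-\mu_{r-i+1}}$ otherwise; and $D$ is the $s\times s$ antisymmetric matrix with $D_{ij}=f_{(\lambda_i,\lambda_j)}$ for $1\le i<j\le s$. Pfaffian: for an antisymmetric $2N\times 2N$ matrix $A=(a_{ij})$, $\mathrm{Pf}(A)=\sum_\sigma\mathrm{sgn}(\sigma)a_{\sigma(1)\sigma(2)}\cdots a_{\sigma(2N-1)\sigma(2N)}$ over $\sigma\in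 S_{2N}$ with $\sigma(2i-1)<\sigma(2i)$ for all $1\le i\le N$ and $\sigma(2j-1)<\sigma(2j+1)$ for all $1\le j\le N-1$. *)

theory Defs
  imports
    "HOL-Library.Poly_Mapping"
    "HOL-Computational_Algebra.Computational_Algebra"
    "HOL-Combinatorics.Permutations"
    "Jordan_Normal_Form.Matrix"
begin

no_notation vec_index (infixl \<open>$\<close> 100)

section \<open>The ring \<open>\<Gamma> = \<rat>(t)[p\<^sub>1, p\<^sub>3, p\<^sub>5, \<dots>]\<close>\<close>

type_synonym Qt = "rat poly fract"

definition tvar :: Qt where
  "tvar = Fract [:0, 1:] 1"

text \<open>
  An exponent vector \<open>m :: nat \<Rightarrow>\<^sub>0 nat\<close> stands for the monomial
  \<open>\<Prod>i. p\<^bsub>2i+1\<^esub> ^ lookup m i\<close>, so the variable with index \<open>i\<close> is \<open>p\<^bsub>2i+1\<^esub>\<close> and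
  the monomials are exactly the \<open>p\<^sub>\<lambda>\<close> with all parts of \<open>\<lambda>\<close> odd.
\<close>

type_synonym Gam = "(nat \<Rightarrow>\<^sub>0 nat) \<Rightarrow>\<^sub>0 Qt"

definition scal :: "Qt \<Rightarrow> Gam \<Rightarrow> Gam" where
  "scal c u = Poly_Mapping.single 0 c * u"

text \<open>\<open>pvar n\<close> and \<open>pdiff n\<close> are \<open>p\<^sub>n\<close> and \<open>\<partial>/\<partial>p\<^sub>n\<close>; both are meant for odd \<open>n\<close> only.\<close>

definition pvar :: "nat \<Rightarrow> Gam" where
  "pvar n = Poly_Mapping.single (Poly_Mapping.single (n div 2) 1) 1"

definition pdiff :: "nat \<Rightarrow> Gam \<Rightarrow> Gam" where
  "pdiff n u = (\<Sum>m\<in>Poly_Mapping.keys u.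
     Poly_Mapping.single (m - Poly_Mapping.single (n div 2) 1)
       (of_nat (Poly_Mapping.lookup m (n div 2)) * Poly_Mapping.lookup u m))"

text \<open>For the monomial \<open>m = p\<^sub>\<lambda>\<close>, \<open>mon_z m = z\<^sub>\<lambda>\<close> and \<open>mon_l m = l(\<lambda>)\<close>.\<close>

definition mon_z :: "(nat \<Rightarrow>\<^sub>0 nat) \<Rightarrow> nat" where
  "mon_z m = (\<Prod>i\<in>Poly_Mapping.keys m.
     (2 * i + 1) ^ Poly_Mapping.lookup m i * fact (Poly_Mapping.lookup m i))"

definition mon_l :: "(nat \<Rightarrow>\<^sub>0 nat) \<Rightarrow> nat" where
  "mon_l m = (\<Sum>i\<in>Poly_Mapping.keys m. Poly_Mapping.lookup m i)"

definition pform :: "Gam \<Rightarrow> Gam \<Rightarrow> Qt" where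
  "pform u v = (\<Sum>m\<in>Poly_Mapping.keys u.
     Poly_Mapping.lookup u m * Poly_Mapping.lookup v m * (of_nat (mon_z m) / 2 ^ mon_l m))"


section \<open>Exponential series and operators\<close>

text \<open>\<open>exp F = \<Sum>k. F\<^sup>k / k!\<close> for \<open>F\<close> without constant term: the terms with \<open>k > n\<close> do not
  contribute to the coefficient of \<open>z\<^sup>n\<close>. The same holds for \<open>ops_exp\<close> below.\<close>

definition exp_series :: "Gam fps \<Rightarrow> Gam fps" where
  "exp_series F = Abs_fps (\<lambda>n. \<Sum>k\<le>n. scal (1 / fact k) (F ^ k $ n))"

text \<open>A power series \<open>\<Sum>n. A\<^sub>n w\<^sup>n\<close> whose coefficients are operators on \<open>\<Gamma>\<close>,
  with composition of operators as the multiplication of coefficients.\<close>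

type_synonym opser = "nat \<Rightarrow> Gam \<Rightarrow> Gam"

definition ops_mult :: "opser \<Rightarrow> opser \<Rightarrow> opser" where
  "ops_mult A B = (\<lambda>n u. \<Sum>i\<le>n. A i (B (n - i) u))"

fun ops_power :: "opser \<Rightarrow> nat \<Rightarrow> opser" where
  "ops_power A 0 = (\<lambda>n u. if n = 0 then u else 0)"
| "ops_power A (Suc k) = ops_mult A (ops_power A k)"

definition ops_exp :: "opser \<Rightarrow> opser" where
  "ops_exp A = (\<lambda>n u. \<Sum>k\<le>n. scal (1 / fact k) (ops_power A k n u))"

definition Q_mult :: "Gam fps" where
  "Q_mult = exp_series (Abs_fps (\<lambda>n. if odd n then scal (2 / of_nat n) (pvar n) else 0))"

text \<open>The variable of this operator series is \<open>z\<^sup>-\<^sup>1\<close>.\<close>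

definition Q_diff :: opser where
  "Q_diff = ops_exp (\<lambda>n u. if odd n then - pdiff n u else 0)"

text \<open>The coefficient of \<open>z\<^sup>n\<close> collects all products of a \<open>z\<^bsup>n+j\<^esup>\<close> and a \<open>z\<^bsup>-j\<^esup>\<close> coefficient;
  only finitely many \<open>j\<close> contribute, see \<open>Q_diff_finite\<close> below.\<close>

definition Q_op :: "int \<Rightarrow> Gam \<Rightarrow> Gam" where
  "Q_op n u = Sum_any (\<lambda>j. if n + int j \<ge> 0 then Q_mult $ nat (n + int j) * Q_diff j u else 0)"

definition Q_fun :: "nat list \<Rightarrow> Gam" where
  "Q_fun l = foldr (\<lambda>n. Q_op (int n)) l 1"

definition g_fun :: "nat \<Rightarrow> Gam" where
  "g_fun n = exp_series (Abs_fps (\<lambda>n. if odd n then scal (2 * (tvar ^ n - 1) / of_nat n) (pvar n) else 0)) $ n"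

text \<open>Existence and uniqueness of the adjoint are \<open>g_adj_eq\<close> and \<open>g_adj_adjoint\<close> below.\<close>

definition g_adj :: "nat \<Rightarrow> Gam \<Rightarrow> Gam" where
  "g_adj n = (THE h. \<forall>u v. pform (g_fun n * u) v = pform u (h v))"


section \<open>Strict partitions\<close>

definition strict_partitions :: "nat \<Rightarrow> nat list set" where
  "strict_partitions n = {l. sorted_wrt (>) l \<and> (\<forall>x\<in>set l. x > 0) \<and> sum_list l = n}"

definition part :: "nat list \<Rightarrow> nat \<Rightarrow> nat" where
  "part l i = (if i < length l then l ! i else 0)"

definition part_le :: "nat list \<Rightarrow> nat list \<Rightarrow> bool" where
  "part_le \<mu> l \<longleftrightarrow> (\<forall>i. part \<mu> i \<le> part l i)"


section \<open>The matrix and its Pfaffian\<close>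

definition f_poly :: "int \<Rightarrow> Qt" where
  "f_poly i = (if i < 0 then 0 else if i = 0 then 1
          else 2 * (tvar - 1) * ((tvar ^ nat i - (- 1) ^ nat i) / (tvar + 1)))"

definition f_pair :: "nat \<Rightarrow> nat \<Rightarrow> Qt" where
  "f_pair m n = (if n = 0 then f_poly (int m)
     else f_poly (int m) * f_poly (int n) + 2 * (\<Sum>a = 1..n. (- 1) ^ a * f_poly (int m + int a) * f_poly (int n - int a)))"

definition pad :: "nat list \<Rightarrow> nat list \<Rightarrow> nat list" where
  "pad l \<mu> = (if even (length l + length \<mu>) then \<mu> else \<mu> @ [0])"

text \<open>Rows and columns are numbered from 0, so the part \<open>\<mu>\<^bsub>r-i+1\<^esub>\<close> of row \<open>i\<close> (counted from 1)
  becomes \<open>\<mu> ! (r - 1 - i)\<close>.\<close>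

definition B_mat :: "nat list \<Rightarrow> nat list \<Rightarrow> Qt mat" where
  "B_mat l \<mu> = (let r = length \<mu> in mat r (length l) (\<lambda>(i, j).
     if i = 0 \<and> \<mu> ! (r - 1) = 0 then f_poly (int (l ! j))
     else 2 * (- 1) ^ (\<mu> ! (r - 1 - i)) * f_poly (int (l ! j) - int (\<mu> ! (r - 1 - i)))))"

definition D_mat :: "nat list \<Rightarrow> Qt mat" where
  "D_mat l = mat (length l) (length l) (\<lambda>(i, j).
     if i < j then f_pair (l ! i) (l ! j) else if j < i then - f_pair (l ! j) (l ! i) else 0)"

definition M_mat :: "nat list \<Rightarrow> nat list \<Rightarrow> Qt mat" where
  "M_mat l \<mu> = (let \<mu>' = pad l \<mu>; B = B_mat l \<mu>' in
     four_block_mat (0\<^sub>m (length \<mu>') (length \<mu>')) B (- transpose_mat B) (D_mat l))"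

text \<open>For \<open>A\<close> antisymmetric of size \<open>2N \<times> 2N\<close>; indices and arguments of \<open>\<sigma>\<close> start from 0.\<close>

definition pfaffian :: "'a::comm_ring_1 mat \<Rightarrow> 'a" where
  "pfaffian A = (let N = dim_row A div 2 in
     \<Sum>\<sigma> | \<sigma> permutes {..<2 * N} \<and> (\<forall>i<N. \<sigma> (2 * i) < \<sigma> (2 * i + 1)) \<and>
            (\<forall>j. j + 1 < N \<longrightarrow> \<sigma> (2 * j) < \<sigma> (2 * (j + 1))).
       of_int (sign \<sigma>) * (\<Prod>i<N. A $$ (\<sigma> (2 * i), \<sigma> (2 * i + 1))))"


section \<open>The definitions are meaningful\<close>

text \<open>The sum in \<open>Q_op\<close> and the sums over strict partitions are finite, and \<open>g_adj\<close> is the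
  unique adjoint, with the expected generating series.\<close>

lemma finite_strict_partitions: "finite (strict_partitions n)"
proof (rule finite_subset)
  have len: "length l \<le> sum_list l" if "\<forall>x\<in>set l. x > 0" for l :: "nat list"
    using that by (induction l) auto
  show "strict_partitions n \<subseteq> {l. set l \<subseteq> {..n} \<and> length l \<le> n}"
    using len member_le_sum_list by (fastforce simp: strict_partitions_def)
  show "finite {l. set l \<subseteq> {..n} \<and> length l \<le> n}"
    by (rule finite_lists_length_le) simp
qed

lemma lookup_scal [simp]: "Poly_Mapping.lookup (scal c u) m = c * Poly_Mapping.lookup u m"
proof -
  have "scal c u = Poly_Mapping.map ((*) c) u"
    by (simp add: scal_def mult_map_scale_conv_mult)
  then show ?thesis by (simp add: Poly_Mapping.map.rep_eq when_def)
qed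

lemma lookup_pdiff:
  "Poly_Mapping.lookup (pdiff n u) m = of_nat (Poly_Mapping.lookup m (n div 2) + 1) *
     Poly_Mapping.lookup u (m + Poly_Mapping.single (n div 2) 1)"
proof -
  let ?e = "Poly_Mapping.single (n div 2) (1 :: nat)"
  let ?c = "\<lambda>m'. of_nat (Poly_Mapping.lookup m' (n div 2)) * Poly_Mapping.lookup u m'"
  have shift: "m' = m + ?e" if "m' - ?e = m" "Poly_Mapping.lookup m' (n div 2) \<noteq> 0" for m'
  proof (rule poly_mapping_eqI)
    fix k
    show "Poly_Mapping.lookup m' k = Poly_Mapping.lookup (m + ?e) k"
      using that by (auto simp: lookup_add lookup_minus lookup_single when_def)
  qed
  have "Poly_Mapping.lookup (pdiff n u) m =
      (\<Sum>m'\<in>Poly_Mapping.keys u. if m' = m + ?e then ?c m' else 0)"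
    unfolding pdiff_def lookup_sum
  proof (rule sum.cong[OF refl])
    fix m' assume "m' \<in> Poly_Mapping.keys u"
    show "Poly_Mapping.lookup (Poly_Mapping.single (m' - ?e) (?c m')) m =
        (if m' = m + ?e then ?c m' else 0)"
    proof (cases "m' = m + ?e")
      case True
      then show ?thesis by simp
    next
      case False
      then have "m' - ?e \<noteq> m \<or> ?c m' = 0" using shift[of m'] by auto
      with False show ?thesis by (metis lookup_single_not_eq single_zero lookup_zero)
    qed
  qed
  also have "\<dots> = ?c (m + ?e)"
    by (auto simp: in_keys_iff)
  finally show ?thesis by (simp add: lookup_add)
qed

definition mon_w :: "(nat \<Rightarrow>\<^sub>0 nat) \<Rightarrow> Qt" where
  "mon_w m = of_nat (mon_z m) / 2 ^ mon_l m"

lemma pform_superset: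
  assumes "finite S" "Poly_Mapping.keys u \<subseteq> S"
  shows "pform u v = (\<Sum>m\<in>S. Poly_Mapping.lookup u m * Poly_Mapping.lookup v m * mon_w m)"
  unfolding pform_def mon_w_def
  by (rule sum.mono_neutral_left) (use assms in \<open>auto simp: in_keys_iff\<close>)

lemma pform_add_left: "pform (u + u') v = pform u v + pform u' v"
proof -
  let ?S = "Poly_Mapping.keys u \<union> Poly_Mapping.keys u'"
  have k: "Poly_Mapping.keys (u + u') \<subseteq> ?S" by (rule keys_add)
  show ?thesis
    by (simp add: pform_superset[of ?S u v] pform_superset[of ?S u' v]
        pform_superset[of ?S "u + u'" v] k lookup_add algebra_simps sum.distrib)
qed

lemma pform_add_right: "pform u (v + v') = pform u v + pform u v'"
  by (simp add: pform_def lookup_add algebra_simps sum.distrib)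

lemma pform_zero [simp]: "pform 0 v = 0" "pform u 0 = 0"
  by (simp_all add: pform_def)

lemma pform_scal_left: "pform (scal c u) v = c * pform u v"
proof -
  have k: "Poly_Mapping.keys (scal c u) \<subseteq> Poly_Mapping.keys u"
    by (auto simp: in_keys_iff)
  show ?thesis
    by (simp add: pform_superset[of "Poly_Mapping.keys u"] k sum_distrib_left mult.assoc)
qed

lemma pform_scal_right: "pform u (scal c v) = c * pform u v"
  by (simp add: pform_def sum_distrib_left algebra_simps)

lemma pform_sum_left: "pform (\<Sum>i\<in>I. a i) v = (\<Sum>i\<in>I. pform (a i) v)"
  by (induction I rule: infinite_finite_induct) (auto simp: pform_add_left)

lemma pform_sum_right: "pform u (\<Sum>i\<in>I. a i) = (\<Sum>i\<in>I. pform u (a i))"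
  by (induction I rule: infinite_finite_induct) (auto simp: pform_add_right)

lemma pform_single: "pform (Poly_Mapping.single m c) v = c * Poly_Mapping.lookup v m * mon_w m"
  by (simp add: pform_superset[of "{m}"])

lemma mon_z_superset:
  assumes "finite S" "Poly_Mapping.keys m \<subseteq> S"
  shows "mon_z m = (\<Prod>i\<in>S. (2 * i + 1) ^ Poly_Mapping.lookup m i * fact (Poly_Mapping.lookup m i))"
  unfolding mon_z_def
  by (rule prod.mono_neutral_left) (use assms in \<open>auto simp: in_keys_iff\<close>)

lemma mon_l_superset:
  assumes "finite S" "Poly_Mapping.keys m \<subseteq> S"
  shows "mon_l m = (\<Sum>i\<in>S. Poly_Mapping.lookup m i)"
  unfolding mon_l_def
  by (rule sum.mono_neutral_left) (use assms in \<open>auto simp: in_keys_iff\<close>)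

lemma of_nat_Qt: "(of_nat n :: Qt) = Fract (of_nat n) 1"
  by (induction n) (simp_all add: Zero_fract_def One_fract_def)

lemma of_nat_Qt_eq_0_iff [simp]: "(of_nat n :: Qt) = 0 \<longleftrightarrow> n = 0"
  unfolding of_nat_Qt Zero_fract_def by (simp add: eq_fract)

lemma two_Qt [simp]: "(2 :: Qt) \<noteq> 0"
  using of_nat_Qt_eq_0_iff[of 2] by simp

lemma mon_w_step:
  "2 * mon_w (m + Poly_Mapping.single i 1) =
     of_nat (2 * i + 1) * of_nat (Poly_Mapping.lookup m i + 1) * mon_w m"
proof -
  let ?e = "Poly_Mapping.single i (1 :: nat)"
  let ?S = "insert i (Poly_Mapping.keys m)"
  let ?R = "Poly_Mapping.keys m - {i}"
  have k: "Poly_Mapping.keys (m + ?e) \<subseteq> ?S"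
    using keys_add[of m ?e] by auto
  have S: "?S = insert i ?R" by auto
  have on: "Poly_Mapping.lookup (m + ?e) i = Suc (Poly_Mapping.lookup m i)"
    by (simp add: lookup_add)
  let ?P = "\<Prod>j\<in>?R. (2 * j + 1) ^ Poly_Mapping.lookup m j * fact (Poly_Mapping.lookup m j)"
  have "(\<Prod>j\<in>?R. (2 * j + 1) ^ Poly_Mapping.lookup (m + ?e) j * fact (Poly_Mapping.lookup (m + ?e) j)) = ?P"
    by (rule prod.cong) (auto simp: lookup_add lookup_single when_def)
  then have z1: "mon_z (m + ?e) = (2 * i + 1) ^ Suc (Poly_Mapping.lookup m i) *
      fact (Suc (Poly_Mapping.lookup m i)) * ?P"
    by (subst mon_z_superset[OF _ k], simp, subst S, subst prod.insert) (simp_all add: on[simplified] del: power_Suc fact_Suc)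
  have z0: "mon_z m = (2 * i + 1) ^ Poly_Mapping.lookup m i *
      fact (Poly_Mapping.lookup m i) * ?P"
    by (subst mon_z_superset[of ?S], simp, blast, subst S, subst prod.insert) auto
  have z: "mon_z (m + ?e) = (2 * i + 1) * (Poly_Mapping.lookup m i + 1) * mon_z m"
    unfolding z1 z0 by (simp add: algebra_simps)
  have "(\<Sum>j\<in>?R. Poly_Mapping.lookup (m + ?e) j) = (\<Sum>j\<in>?R. Poly_Mapping.lookup m j)"
    by (rule sum.cong) (auto simp: lookup_add lookup_single when_def)
  then have l1: "mon_l (m + ?e) = Suc (Poly_Mapping.lookup m i) + (\<Sum>j\<in>?R. Poly_Mapping.lookup m j)"
    by (subst mon_l_superset[OF _ k], simp, subst S, subst sum.insert) (simp_all add: on[simplified])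
  have l0: "mon_l m = Poly_Mapping.lookup m i + (\<Sum>j\<in>?R. Poly_Mapping.lookup m j)"
    by (subst mon_l_superset[of ?S], simp, blast, subst S, subst sum.insert) auto
  have l: "mon_l (m + ?e) = Suc (mon_l m)" unfolding l1 l0 by simp
  have "2 * (a * b * c / (2 * d)) = a * b * (c / d)" for a b c d :: Qt
    by simp
  then show ?thesis unfolding mon_w_def z l of_nat_mult power_Suc .
qed

lemma mon_w_nonzero: "mon_w m \<noteq> 0"
proof -
  have "mon_z m \<noteq> 0" by (simp add: mon_z_def)
  then show ?thesis by (simp add: mon_w_def)
qed

lemma pform_nondegenerate:
  assumes "\<And>u. pform u v = pform u v'"
  shows "v = v'"
proof (rule poly_mapping_eqI)
  fix m
  show "Poly_Mapping.lookup v m = Poly_Mapping.lookup v' m"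
    using assms[of "Poly_Mapping.single m 1"] mon_w_nonzero[of m] by (simp add: pform_single)
qed

lemma sum_monomials:
  fixes u :: Gam
  shows "(\<Sum>m\<in>Poly_Mapping.keys u. Poly_Mapping.single m (Poly_Mapping.lookup u m)) = u"
proof (rule poly_mapping_eqI)
  fix k
  have "(\<Sum>m\<in>Poly_Mapping.keys u. Poly_Mapping.lookup (Poly_Mapping.single m (Poly_Mapping.lookup u m)) k)
      = (\<Sum>m\<in>Poly_Mapping.keys u. if m = k then Poly_Mapping.lookup u k else 0)"
    by (rule sum.cong) (auto simp: lookup_single when_def)
  then show "Poly_Mapping.lookup (\<Sum>m\<in>Poly_Mapping.keys u.
      Poly_Mapping.single m (Poly_Mapping.lookup u m)) k = Poly_Mapping.lookup u k"
    by (simp add: lookup_sum in_keys_iff)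
qed

lemma pform_pvar:
  assumes "odd n"
  shows "pform (pvar n * u) v = of_nat n / 2 * pform u (pdiff n v)"
proof -
  let ?i = "n div 2"
  have n: "2 * ?i + 1 = n" using assms by simp
  have w: "mon_w (m + Poly_Mapping.single ?i 1) =
      of_nat n * of_nat (Poly_Mapping.lookup m ?i + 1) * mon_w m / 2" for m
    using mon_w_step[of m ?i] unfolding n by (simp add: field_simps)
  have single: "pform (pvar n * Poly_Mapping.single m c) v =
      of_nat n / 2 * pform (Poly_Mapping.single m c) (pdiff n v)" for m c
  proof -
    have "pvar n * Poly_Mapping.single m c = Poly_Mapping.single (m + Poly_Mapping.single ?i 1) c"
      by (simp add: pvar_def mult_single add.commute)
    then show ?thesis
      by (simp only: pform_single lookup_pdiff w) (simp add: field_simps)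
  qed
  have "pform (pvar n * (\<Sum>m\<in>Poly_Mapping.keys u. Poly_Mapping.single m (Poly_Mapping.lookup u m))) v =
      of_nat n / 2 * pform (\<Sum>m\<in>Poly_Mapping.keys u.
        Poly_Mapping.single m (Poly_Mapping.lookup u m)) (pdiff n v)"
    by (simp only: sum_distrib_left pform_sum_left single)
  then show ?thesis by (simp only: sum_monomials)
qed

definition adjoint_ops :: "(Gam \<Rightarrow> Gam) \<Rightarrow> (Gam \<Rightarrow> Gam) \<Rightarrow> bool" where
  "adjoint_ops A A' \<longleftrightarrow> (\<forall>u v. pform (A u) v = pform u (A' v))"

definition g_diff :: opser where
  "g_diff = (\<lambda>n u. if odd n then scal (tvar ^ n - 1) (pdiff n u) else 0)"

lemma scal_mult: "scal c x * u = scal c (x * u)"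
  by (simp add: scal_def mult.assoc)

lemma exp_series_adjoint:
  assumes "\<And>n. adjoint_ops (\<lambda>u. F $ n * u) (A n)"
  shows "adjoint_ops (\<lambda>u. exp_series F $ n * u) (ops_exp A n)"
proof -
  have pow: "adjoint_ops (\<lambda>u. F ^ k $ n * u) (ops_power A k n)" for k n
  proof (induction k arbitrary: n)
    case 0
    then show ?case by (simp add: adjoint_ops_def)
  next
    case (Suc k)
    have "pform (F ^ Suc k $ n * u) v = pform u (ops_power A (Suc k) n v)" for u v
    proof -
      have "F ^ Suc k $ n * u = (\<Sum>i\<le>n. F ^ k $ (n - i) * (F $ i * u))"
        by (simp add: fps_mult_nth sum_distrib_right atLeast0AtMost mult.left_commute mult.assoc)
      then have "pform (F ^ Suc k $ n * u) v = (\<Sum>i\<le>n. pform (F ^ k $ (n - i) * (F $ i * u)) v)"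
        by (simp only: pform_sum_left)
      also have "\<dots> = (\<Sum>i\<le>n. pform u (A i (ops_power A k (n - i) v)))"
        using Suc assms by (simp add: adjoint_ops_def)
      finally show ?thesis by (simp add: ops_mult_def pform_sum_right)
    qed
    then show ?case by (simp add: adjoint_ops_def)
  qed
  then show ?thesis
    by (simp add: adjoint_ops_def exp_series_def ops_exp_def sum_distrib_right pform_sum_left
        pform_sum_right scal_mult pform_scal_left pform_scal_right)
qed

lemma g_fun_adjoint: "pform (g_fun n * u) v = pform u (ops_exp g_diff n v)"
proof -
  have "adjoint_ops (\<lambda>u. Abs_fps (\<lambda>n. if odd n
      then scal (2 * (tvar ^ n - 1) / of_nat n) (pvar n) else 0) $ m * u) (g_diff m)" for m
  proof (cases "odd m")
    case True
    then have "m \<noteq> 0" by (cases m) auto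
    then have "(of_nat m :: Qt) \<noteq> 0" by simp
    with True show ?thesis
      by (simp add: adjoint_ops_def g_diff_def scal_mult pform_scal_left pform_scal_right pform_pvar
          del: of_nat_Qt_eq_0_iff)
  qed (simp add: adjoint_ops_def g_diff_def)
  from exp_series_adjoint[OF this] show ?thesis
    unfolding g_fun_def adjoint_ops_def by blast
qed

theorem g_adj_eq: "g_adj n = ops_exp g_diff n"
  unfolding g_adj_def
proof (rule the_equality)
  fix h assume "\<forall>u v. pform (g_fun n * u) v = pform u (h v)"
  then show "h = ops_exp g_diff n"
    by (intro ext pform_nondegenerate) (simp add: g_fun_adjoint)
qed (simp add: g_fun_adjoint)

theorem g_adj_adjoint: "pform (g_fun n * u) v = pform u (g_adj n v)"
  by (simp add: g_adj_eq g_fun_adjoint)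

text \<open>Each coefficient of \<open>w\<^sup>n\<close> lowers the degree, with \<open>p\<^sub>n\<close> of degree \<open>n\<close>, by \<open>n\<close>.\<close>

definition mon_deg :: "(nat \<Rightarrow>\<^sub>0 nat) \<Rightarrow> nat" where
  "mon_deg m = (\<Sum>i\<in>Poly_Mapping.keys m. (2 * i + 1) * Poly_Mapping.lookup m i)"

definition lowering :: "opser \<Rightarrow> bool" where
  "lowering A \<longleftrightarrow> (\<forall>n u m. Poly_Mapping.lookup (A n u) m \<noteq> 0 \<longrightarrow>
     (\<exists>m'. Poly_Mapping.lookup u m' \<noteq> 0 \<and> mon_deg m + n = mon_deg m'))"

lemma mon_deg_step: "mon_deg (m + Poly_Mapping.single i 1) = mon_deg m + (2 * i + 1)"
proof -
  have "mon_deg (m + Poly_Mapping.single i 1) = mon_deg m + mon_deg (Poly_Mapping.single i 1)"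
    unfolding mon_deg_def by (rule setsum_keys_plus_distrib) (auto simp: algebra_simps)
  then show ?thesis by (simp add: mon_deg_def)
qed

lemma lowering_mult:
  assumes "lowering A" "lowering B"
  shows "lowering (ops_mult A B)"
  unfolding lowering_def
proof (intro allI impI)
  fix n u m
  assume "Poly_Mapping.lookup (ops_mult A B n u) m \<noteq> 0"
  then obtain i where i: "i \<le> n" "Poly_Mapping.lookup (A i (B (n - i) u)) m \<noteq> 0"
    by (auto simp: ops_mult_def lookup_sum elim!: sum.not_neutral_contains_not_neutral)
  then obtain m' where m': "Poly_Mapping.lookup (B (n - i) u) m' \<noteq> 0" "mon_deg m + i = mon_deg m'"
    using assms(1) unfolding lowering_def by blast
  then obtain m'' where "Poly_Mapping.lookup u m'' \<noteq> 0" "mon_deg m' + (n - i) = mon_deg m''"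
    using assms(2) unfolding lowering_def by blast
  then show "\<exists>m'. Poly_Mapping.lookup u m' \<noteq> 0 \<and> mon_deg m + n = mon_deg m'"
    using i(1) m'(2) by (intro exI[of _ m'']) simp
qed

lemma lowering_power:
  assumes "lowering A"
  shows "lowering (ops_power A k)"
proof (induction k)
  case 0
  then show ?case by (auto simp: lowering_def)
next
  case (Suc k)
  then show ?case by (simp add: lowering_mult assms)
qed

lemma lowering_exp:
  assumes "lowering A"
  shows "lowering (ops_exp A)"
  unfolding lowering_def
proof (intro allI impI)
  fix n u m
  assume "Poly_Mapping.lookup (ops_exp A n u) m \<noteq> 0"
  then obtain k where "Poly_Mapping.lookup (ops_power A k n u) m \<noteq> 0"
    by (auto simp: ops_exp_def lookup_sum elim!: sum.not_neutral_contains_not_neutral)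
  then show "\<exists>m'. Poly_Mapping.lookup u m' \<noteq> 0 \<and> mon_deg m + n = mon_deg m'"
    using lowering_power[OF assms, of k] unfolding lowering_def by blast
qed

theorem Q_diff_finite: "finite {j. Q_diff j u \<noteq> 0}"
proof -
  have "lowering (\<lambda>n u. if odd n then - pdiff n u else 0)"
    unfolding lowering_def
  proof (intro allI impI)
    fix n u m
    assume *: "Poly_Mapping.lookup (if odd n then - pdiff n u else 0) m \<noteq> 0"
    then have "odd n" by (auto split: if_splits)
    then show "\<exists>m'. Poly_Mapping.lookup u m' \<noteq> 0 \<and> mon_deg m + n = mon_deg m'"
      using * mon_deg_step[of m "n div 2"]
      by (intro exI[of _ "m + Poly_Mapping.single (n div 2) 1"]) (auto simp: lookup_pdiff)
  qed
  then have low: "lowering Q_diff"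
    unfolding Q_diff_def by (rule lowering_exp)
  have "j \<le> Max (mon_deg ` Poly_Mapping.keys u)" if "Q_diff j u \<noteq> 0" for j
  proof -
    from that obtain m where "Poly_Mapping.lookup (Q_diff j u) m \<noteq> 0"
      by (metis lookup_zero poly_mapping_eqI)
    then obtain m' where m': "m' \<in> Poly_Mapping.keys u" "mon_deg m + j = mon_deg m'"
      using low unfolding lowering_def by (metis in_keys_iff)
    then have "mon_deg m' \<le> Max (mon_deg ` Poly_Mapping.keys u)"
      by (intro Max_ge) auto
    with m' show ?thesis by linarith
  qed
  then have "{j. Q_diff j u \<noteq> 0} \<subseteq> {..Max (mon_deg ` Poly_Mapping.keys u)}"
    by auto
  then show ?thesis by (rule finite_subset) simp
qed

end

(* The half vertex operator exp(sum of a_n w^n d/dp_n) is a translation p_n -> p_n + a_n w^n of the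
   polynomial ring, hence multiplicative, and it acts on the series of Q by a scalar series in z/w.
   For the differential part of Q this gives the Clifford relations
   Q_m Q_n + Q_n Q_m = 2 (-1)^m [m + n = 0]; for g^* it gives g^*_k Q_n = sum_i f_i Q_(n-i) g^*_(k-i).
   Straightening with these relations, g^*_k Q_lambda.1 is a combination of the Q_mu.1 with mu strict and
   contained in lambda. The constant term of Q_(-mu_l) ... Q_(-mu_1) Q_nu.1 vanishes for mu <> nu,
   so the coefficient of Q_mu.1 is, up to a factor, the constant term of
   Q_(-mu_l) ... Q_(-mu_1) g^*_k Q_lambda.1. Moving the leftmost operator to the right yields
   for these constant terms (Wick's theorem) the first row expansion of the Pfaffian of M(lambda/mu).
   The extra part 0 of mu corresponds to a leading Q_0, which does not change the constant term. *)

theory Submission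
  imports Defs "Jordan_Normal_Form.Determinant"
begin

section \<open>Half vertex operators\<close>

text \<open>Exponentials are computed with only through the recursion for their coefficients that
  exp' = F' exp provides. Commutation and inversion of the differential exponentials are adjoint to
  identities between multiplications in a commutative ring. The two orders of a product of Q series
  expand (1 - x)/(1 + x) in x and in 1/x. Their sum is the delta series 2 sum (-x)^l over all
  integers l, which makes sense only against finitely many nonzero terms; hence the finite windows
  of summation. The operator Q_0 squares to the identity and does not annihilate 1. This is the
  obstacle in Wick's theorem: carried through a word of odd length, Q_0 returns minus the constant
  term it started from, so each of its contractions loses the factor 2. That is the exceptional
  first row of M(lambda/mu), and the reason to make r + s even. The entries f_(m,n) are the
  contractions of two operators to the right of g^*. The factor 2^(-l(mu)) (-1)^(n-k) inverts the
  constant term for mu = nu.\<close>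

lemma scal_of_nat: "scal (of_nat n) u = of_nat n * u"
  by (simp add: scal_def)

lemma scal_0_left [simp]: "scal 0 u = 0"
  and scal_0_right [simp]: "scal c 0 = 0"
  and scal_1 [simp]: "scal 1 u = u"
  by (simp_all add: scal_def)

lemma scal_add_right: "scal c (u + v) = scal c u + scal c v"
  and scal_minus_right: "scal c (- u) = - scal c u"
  by (simp_all add: scal_def algebra_simps)

lemma scal_add_left: "scal (c + d) u = scal c u + scal d u"
  and scal_minus_left: "scal (- c) u = - scal c u"
  by (simp_all add: scal_def algebra_simps single_add single_uminus)

lemma scal_scal [simp]: "scal c (scal d u) = scal (c * d) u"
  by (simp add: scal_def mult.assoc[symmetric] mult_single)

lemma mult_scal: "u * scal c x = scal c (u * x)"
  by (simp add: scal_def mult.left_commute)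

lemma scal_sum_right: "scal c (sum f A) = (\<Sum>x\<in>A. scal c (f x))"
  by (simp add: scal_def sum_distrib_left)

lemma scal_sum_left: "scal (sum f A) u = (\<Sum>x\<in>A. scal (f x) u)"
  by (induction A rule: infinite_finite_induct) (simp_all add: scal_add_left)

lemma of_nat_mult_cancel_Gam:
  fixes u v :: Gam
  assumes "of_nat n * u = of_nat n * v" "n > 0"
  shows "u = v"
proof -
  have "scal (1 / of_nat n) (scal (of_nat n) u) = scal (1 / of_nat n) (scal (of_nat n) v)"
    using assms(1) by (simp only: scal_of_nat)
  then show ?thesis using assms(2) by simp
qed

section \<open>Exponential series through their differential equation\<close>

lemma fps_deriv_exp_series:
  fixes F :: "Gam fps"
  assumes "F $ 0 = 0"
  shows "fps_deriv (exp_series F) = fps_deriv F * exp_series F"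
proof (rule fps_ext)
  fix m
  \<comment> \<open>\<open>F ^ k\<close> has no terms below degree k, so all coefficients up to
    \<open>m\<close> may be summed over the common range k <= m.\<close>
  have E: "exp_series F $ q = (\<Sum>k\<le>m. scal (1 / fact k) (F ^ k $ q))" if "q \<le> m" for q
    unfolding exp_series_def fps_nth_Abs_fps
    by (rule sum.mono_neutral_left) (use that startsby_zero_power_prefix[OF assms] in auto)
  have D: "scal (1 / fact (Suc k)) (of_nat (Suc m) * F ^ Suc k $ Suc m) =
      (\<Sum>i\<le>m. fps_deriv F $ i * scal (1 / fact k) (F ^ k $ (m - i)))" for k
  proof -
    have "of_nat (Suc m) * F ^ Suc k $ Suc m = fps_deriv (F ^ Suc k) $ m"
      by (simp del: power_Suc)
    also have "\<dots> = of_nat (Suc k) * (\<Sum>i\<le>m. fps_deriv F $ i * F ^ k $ (m - i))"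
      by (subst fps_deriv_power)
        (simp add: mult.assoc fps_mult_left_const_nth fps_mult_nth[of "fps_deriv F"] atLeast0AtMost
          del: fps_deriv_nth of_nat_Suc)
    finally have "scal (1 / fact (Suc k)) (of_nat (Suc m) * F ^ Suc k $ Suc m) =
        scal (1 / fact (Suc k) * of_nat (Suc k)) (\<Sum>i\<le>m. fps_deriv F $ i * F ^ k $ (m - i))"
      by (simp only: scal_of_nat[symmetric] scal_scal)
    also have "1 / fact (Suc k) * of_nat (Suc k) = (1 / fact k :: Qt)"
    proof -
      have "(of_nat (Suc k) :: Qt) \<noteq> 0" by (simp only: of_nat_Qt_eq_0_iff)
      then show ?thesis unfolding fact_Suc by (simp del: of_nat_Suc of_nat_Qt_eq_0_iff)
    qed
    finally show ?thesis
      by (simp only: scal_sum_right mult_scal)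
  qed
  have "fps_deriv (exp_series F) $ m =
      (\<Sum>k\<le>Suc m. scal (1 / fact k) (of_nat (Suc m) * F ^ k $ Suc m))"
    by (simp only: fps_deriv_nth exp_series_def fps_nth_Abs_fps sum_distrib_left mult_scal
        Suc_eq_plus1)
  also have "\<dots> = (\<Sum>k\<le>m. scal (1 / fact (Suc k)) (of_nat (Suc m) * F ^ Suc k $ Suc m))"
    by (subst sum.atMost_Suc_shift) (simp del: power_Suc fact_Suc)
  also have "\<dots> = (\<Sum>i\<le>m. fps_deriv F $ i * (\<Sum>k\<le>m. scal (1 / fact k) (F ^ k $ (m - i))))"
    unfolding D by (subst sum.swap) (simp only: sum_distrib_left)
  also have "\<dots> = (fps_deriv F * exp_series F) $ m"
    unfolding fps_mult_nth atLeast0AtMost by (rule sum.cong) (simp_all only: E diff_le_self refl)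
  finally show "fps_deriv (exp_series F) $ m = (fps_deriv F * exp_series F) $ m" .
qed

lemma exp_series_nth_0: "exp_series F $ 0 = 1"
  by (simp add: exp_series_def)

text \<open>Comparison of coefficients in exp' = F' exp. As n > 0 is invertible, this determines the
  series from its constant term.\<close>

lemma exp_series_rec:
  fixes F :: "Gam fps"
  assumes "F $ 0 = 0"
  shows "of_nat n * exp_series F $ n = (\<Sum>i\<le>n. of_nat i * F $ i * exp_series F $ (n - i))"
proof (cases n)
  case (Suc m)
  have "of_nat n * exp_series F $ n = fps_deriv (exp_series F) $ m"
    by (simp add: Suc)
  also have "\<dots> = (\<Sum>i\<le>m. of_nat (Suc i) * F $ Suc i * exp_series F $ (m - i))"
    unfolding fps_deriv_exp_series[OF assms]
    by (simp add: fps_mult_nth atLeast0AtMost)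
  finally show ?thesis
    unfolding Suc by (subst sum.atMost_Suc_shift) simp
qed simp

definition pvar_odd :: "nat \<Rightarrow> Gam" where
  "pvar_odd n = (if odd n then pvar n else 0)"

definition pdiff_odd :: "nat \<Rightarrow> Gam \<Rightarrow> Gam" where
  "pdiff_odd n u = (if odd n then pdiff n u else 0)"

text \<open>The weight 2/n makes multiplication by the n-th summand of the exponent adjoint to a_n
  d/dp_n, so \<open>exp_odd a\<close> and \<open>shift_ops a\<close> are adjoint coefficient by
  coefficient.\<close>

definition exp_odd :: "(nat \<Rightarrow> Qt) \<Rightarrow> Gam fps" where
  "exp_odd a = exp_series (Abs_fps (\<lambda>n. scal (2 * a n / of_nat n) (pvar_odd n)))"

definition shift_ops :: "(nat \<Rightarrow> Qt) \<Rightarrow> opser" where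
  "shift_ops a = ops_exp (\<lambda>n u. scal (a n) (pdiff_odd n u))"

lemma exp_odd_0: "exp_odd a $ 0 = 1"
  by (simp add: exp_odd_def exp_series_nth_0)

lemma exp_odd_rec:
  "of_nat n * exp_odd a $ n = (\<Sum>i\<le>n. scal (2 * a i) (pvar_odd i * exp_odd a $ (n - i)))"
proof -
  have "of_nat i * scal (2 * a i / of_nat i) (pvar_odd i) = scal (2 * a i) (pvar_odd i)" for i
  proof (cases "i = 0")
    case False
    then show ?thesis by (simp flip: scal_of_nat)
  qed (simp add: pvar_odd_def)
  then show ?thesis
    unfolding exp_odd_def by (subst exp_series_rec) (simp_all add: scal_mult)
qed

text \<open>The exponent is odd in z, so E(-z) is the inverse of E(z).\<close>

lemma exp_odd_neg:
  "(\<Sum>p\<le>r. (-1) ^ p * exp_odd a $ p * exp_odd a $ (r - p)) = (if r = 0 then 1 else 0)"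
proof (cases "r = 0")
  case False
  define E where "E = exp_odd a"
  define N where "N = Abs_fps (\<lambda>p. (-1) ^ p * E $ p)"
  define P where "P = Abs_fps (\<lambda>i. scal (2 * a i) (pvar_odd i))"
  have E: "fps_X * fps_deriv E = P * E"
  proof (rule fps_ext)
    fix n
    have "(fps_X * fps_deriv E) $ n = of_nat n * E $ n"
      by (cases n) simp_all
    then show "(fps_X * fps_deriv E) $ n = (P * E) $ n"
      by (simp add: E_def P_def exp_odd_rec fps_mult_nth atLeast0AtMost scal_mult)
  qed
  have N: "fps_X * fps_deriv N = - (P * N)"
  proof (rule fps_ext)
    fix n
    have "(-1) ^ n * (P $ i * E $ (n - i)) = - (P $ i * ((-1) ^ (n - i) * E $ (n - i)))"
      if "i \<le> n" for i
    proof (cases "odd i")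
      case True
      then have "(-1 :: Gam) ^ n = - ((-1) ^ (n - i))"
        using that by (auto simp: minus_one_power_iff)
      then show ?thesis by (simp add: algebra_simps)
    qed (simp add: P_def pvar_odd_def)
    then have "(-1) ^ n * (P * E) $ n = - (P * N) $ n"
      by (simp add: N_def fps_mult_nth atLeast0AtMost sum_distrib_left sum_negf)
    moreover have "(fps_X * fps_deriv N) $ n = (-1) ^ n * (fps_X * fps_deriv E) $ n"
      by (cases n) (simp_all add: N_def mult.left_commute)
    ultimately show "(fps_X * fps_deriv N) $ n = (- (P * N)) $ n"
      by (simp add: E)
  qed
  \<comment> \<open>The operator z d/dz multiplies E by P and N by -P, hence it annihilates N E; for
    r > 0 this forces the coefficient to be 0.\<close>
  have "of_nat r * (N * E) $ r = (fps_X * fps_deriv (N * E)) $ r"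
    by (cases r) (simp_all del: fps_deriv_mult)
  also have "fps_X * fps_deriv (N * E) = N * (fps_X * fps_deriv E) + (fps_X * fps_deriv N) * E"
    by (simp add: algebra_simps)
  also have "\<dots> = 0" unfolding E N by (simp add: algebra_simps)
  finally have "of_nat r * (N * E) $ r = 0" by simp
  then have "(N * E) $ r = 0"
    using of_nat_mult_cancel_Gam[of r "(N * E) $ r" 0] False by simp
  then show ?thesis
    using False by (simp add: N_def E_def fps_mult_nth atLeast0AtMost)
qed (simp add: exp_odd_0)

section \<open>Adjoints of multiplications\<close>

text \<open>Since the form is nondegenerate, an adjoint is determined by the multiplier; identities
  between multipliers therefore become identities between differential operators.\<close>

definition mult_adj :: "Gam \<Rightarrow> (Gam \<Rightarrow> Gam) \<Rightarrow> bool" where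
  "mult_adj e A \<longleftrightarrow> (\<forall>u v. pform (e * u) v = pform u (A v))"

lemma mult_adj_unique: "mult_adj e A \<Longrightarrow> mult_adj e B \<Longrightarrow> A u = B u"
  by (rule pform_nondegenerate) (simp add: mult_adj_def)

lemma mult_adjD: "mult_adj e A \<Longrightarrow> pform u (A v) = pform (e * u) v"
  by (simp add: mult_adj_def)

lemma mult_adj_add: "mult_adj e A \<Longrightarrow> A (u + v) = A u + A v"
  by (rule pform_nondegenerate) (simp add: mult_adjD pform_add_right)

lemma mult_adj_scal: "mult_adj e A \<Longrightarrow> A (scal c u) = scal c (A u)"
  by (rule pform_nondegenerate) (simp add: mult_adjD pform_scal_right)

lemma mult_adj_0: "mult_adj e A \<Longrightarrow> A 0 = 0"
  using mult_adj_scal[of e A 0 0] by simp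

lemma mult_adj_sum: "mult_adj e A \<Longrightarrow> A (\<Sum>i\<in>I. f i) = (\<Sum>i\<in>I. A (f i))"
  by (induction I rule: infinite_finite_induct) (simp_all add: mult_adj_add mult_adj_0)

lemma mult_adj_compose: "mult_adj e A \<Longrightarrow> mult_adj e' A' \<Longrightarrow> mult_adj (e * e') (\<lambda>u. A' (A u))"
  by (simp add: mult_adj_def mult.assoc mult.left_commute) 

lemma mult_adj_commute: "mult_adj e A \<Longrightarrow> mult_adj e' A' \<Longrightarrow> A (A' u) = A' (A u)"
  using mult_adj_unique[OF mult_adj_compose[of e' A' e A] mult_adj_compose[of e A e' A', unfolded mult.commute[of e]]] .

lemma mult_adj_lincomb:
  "(\<And>i. i \<in> I \<Longrightarrow> mult_adj (e i) (A i)) \<Longrightarrow> mult_adj (\<Sum>i\<in>I. scal (c i) (e i)) (\<lambda>u. \<Sum>i\<in>I. scal (c i)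
      (A i u))"
  by (simp add: mult_adj_def sum_distrib_right pform_sum_left pform_sum_right scal_mult
      pform_scal_left pform_scal_right)

lemma mult_adj_pdiff_odd: "mult_adj (scal (2 / of_nat n) (pvar_odd n)) (pdiff_odd n)"
proof (cases "odd n")
  case True
  then have "(of_nat n :: Qt) \<noteq> 0" by (auto intro!: Nat.gr0I)
  with True show ?thesis
    by (simp add:
        mult_adj_def pvar_odd_def pdiff_odd_def scal_mult pform_scal_left pform_pvar del: of_nat_Qt_eq_0_iff)
qed (simp add: mult_adj_def pvar_odd_def pdiff_odd_def)

lemma mult_adj_shift_ops: "mult_adj (exp_odd a $ n) (shift_ops a n)"
proof -
  have "adjoint_ops (\<lambda>u. Abs_fps (\<lambda>n. scal (2 * a n / of_nat n) (pvar_odd n)) $ m * u)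
      (\<lambda>u. scal (a m) (pdiff_odd m u))" for m
  proof -
    have "scal (2 * a m / of_nat m) (pvar_odd m) = scal (a m) (scal (2 / of_nat m) (pvar_odd m))"
      by (simp add: mult.commute)
    then show ?thesis
      using mult_adj_pdiff_odd[of m]
      by (simp only: adjoint_ops_def mult_adj_def fps_nth_Abs_fps scal_mult[of "a m"]
          pform_scal_left[of "a m"] pform_scal_right simp_thms)
  qed
  from exp_series_adjoint[OF this] show ?thesis
    by (simp add: mult_adj_def exp_odd_def shift_ops_def adjoint_ops_def)
qed

lemmas shift_ops_add = mult_adj_add[OF mult_adj_shift_ops]
  and shift_ops_scal = mult_adj_scal[OF mult_adj_shift_ops]
  and shift_ops_sum = mult_adj_sum[OF mult_adj_shift_ops]
  and shift_ops_zero = mult_adj_0[OF mult_adj_shift_ops]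
  and shift_ops_commute = mult_adj_commute[OF mult_adj_shift_ops mult_adj_shift_ops]
  and pdiff_odd_scal = mult_adj_scal[OF mult_adj_pdiff_odd]
  and pdiff_odd_sum = mult_adj_sum[OF mult_adj_pdiff_odd]
  and pdiff_odd_0 = mult_adj_0[OF mult_adj_pdiff_odd]

lemma shift_ops_0: "shift_ops a 0 u = u"
  using mult_adj_unique[OF mult_adj_shift_ops[of a 0], of "\<lambda>u. u"] by (simp add:
      exp_odd_0 mult_adj_def)

text \<open>The adjoint of \<open>exp_odd_rec\<close>, summand by summand.\<close>

lemma shift_ops_rec:
  "of_nat n * shift_ops a n u = (\<Sum>i\<le>n. scal (of_nat i * a i) (pdiff_odd i (shift_ops a (n - i) u)))"
proof -
  have l: "mult_adj (of_nat n * exp_odd a $ n) (\<lambda>u. of_nat n * shift_ops a n u)"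
    using mult_adj_shift_ops[of a n]
    by (simp add: mult_adj_def scal_mult pform_scal_left pform_scal_right flip: scal_of_nat)
  have e: "scal (2 * a i) (pvar_odd i * x) = scal (of_nat i * a i) (exp_odd b $ j * (scal
      (2 / of_nat i) (pvar_odd i)))"
    if "x = exp_odd b $ j" for i j x b
    using that by (cases "i = 0") (simp_all add: mult_scal scal_mult pvar_odd_def mult.commute)
  have "mult_adj (of_nat n * exp_odd a $ n)
      (\<lambda>u. \<Sum>i\<le>n. scal (of_nat i * a i) (pdiff_odd i (shift_ops a (n - i) u)))"
    unfolding exp_odd_rec e[OF refl]
    by (intro mult_adj_lincomb)
        (metis mult_adj_compose mult_adj_pdiff_odd mult_adj_shift_ops mult.commute)
  then show ?thesis by (rule mult_adj_unique[OF l])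
qed

section \<open>The Leibniz rule and multiplicativity of the shift\<close>

lemma Gam_induct [case_names single add]:
  fixes u :: Gam
  assumes single: "\<And>m c. P (Poly_Mapping.single m c)"
    and add: "\<And>u v. P u \<Longrightarrow> P v \<Longrightarrow> P (u + v)"
  shows "P u"
proof -
  have "P 0" using single[of 0 0] by simp
  then have "P (\<Sum>m\<in>S. Poly_Mapping.single m (Poly_Mapping.lookup u m))" for S
    by (induction S rule: infinite_finite_induct) (auto intro: single add)
  from this[of "Poly_Mapping.keys u"] show ?thesis by (simp only: sum_monomials)
qed

lemma pdiff_add: "pdiff n (u + v) = pdiff n u + pdiff n v"
  by (rule poly_mapping_eqI) (simp add: lookup_pdiff lookup_add algebra_simps)

lemma pdiff_zero: "pdiff n 0 = 0"
  by (simp add: pdiff_def)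

lemma pdiff_single:
  "pdiff n (Poly_Mapping.single m c) = Poly_Mapping.single (m - Poly_Mapping.single (n div 2) 1)
     (of_nat (Poly_Mapping.lookup m (n div 2)) * c)"
  by (cases "c = 0") (simp_all add: pdiff_def)

text \<open>By additivity monomials suffice. Subtraction of exponents truncates when the variable is
  absent, but then the coefficient is 0.\<close>

lemma pdiff_mult: "pdiff n (u * v) = pdiff n u * v + u * pdiff n v"
proof -
  let ?i = "n div 2"
  let ?e = "Poly_Mapping.single ?i (1::nat)"
  have shift: "m + m' - ?e = (m - ?e) + m'" if "Poly_Mapping.lookup m ?i \<noteq> 0" for m m'
    by (rule poly_mapping_eqI)
        (use that in \<open>auto simp: lookup_add lookup_minus lookup_single when_def\<close>)
  have *: "Poly_Mapping.single (m + m' - ?e) (of_nat (Poly_Mapping.lookup m ?i) * c) =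
      Poly_Mapping.single ((m - ?e) + m') (of_nat (Poly_Mapping.lookup m ?i) *
          (c :: Qt))" for m m' c
  proof (cases "Poly_Mapping.lookup m ?i = 0")
    case False
    then show ?thesis by (simp only: shift[OF False])
  qed simp
  have mono: "pdiff n (Poly_Mapping.single m c * Poly_Mapping.single m' c') =
      pdiff n (Poly_Mapping.single m c) * Poly_Mapping.single m' c' +
      Poly_Mapping.single m c * pdiff n (Poly_Mapping.single m' c')" for m m' c c'
  proof -
    have "pdiff n (Poly_Mapping.single m c * Poly_Mapping.single m' c') =
      Poly_Mapping.single (m + m' - ?e) (of_nat (Poly_Mapping.lookup m ?i) * (c * c')) +
      Poly_Mapping.single (m' + m - ?e) (of_nat (Poly_Mapping.lookup m' ?i) * (c * c'))"
      by (simp add: mult_single pdiff_single lookup_add algebra_simps flip: single_add)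
    then show ?thesis
      unfolding * by (simp add: mult_single pdiff_single algebra_simps)
  qed
  have left: "pdiff n (u * Poly_Mapping.single m' c') =
      pdiff n u * Poly_Mapping.single m' c' + u * pdiff n (Poly_Mapping.single m' c')" for u m' c'
    by (induction u rule: Gam_induct) (simp_all add: mono distrib_right pdiff_add)
  show ?thesis
    by (induction v rule: Gam_induct) (simp_all add: left distrib_left pdiff_add)
qed

lemma pdiff_odd_mult: "pdiff_odd n (u * v) = pdiff_odd n u * v + u * pdiff_odd n v"
  by (simp add: pdiff_odd_def pdiff_mult)

lemma pdiff_odd_one: "pdiff_odd n 1 = 0"
  using pdiff_odd_mult[of n 1 1] by simp

lemma pdiff_odd_pvar_odd: "odd i \<Longrightarrow> pdiff_odd i (pvar_odd j) = (if i = j then 1 else 0)"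
  by (auto simp: pdiff_odd_def pvar_odd_def pvar_def pdiff_single pdiff_zero lookup_single when_def elim!: oddE)

lemma sum_triangle_assoc:
  fixes g :: "nat \<Rightarrow> nat \<Rightarrow> nat \<Rightarrow> 'a::comm_monoid_add"
  shows "(\<Sum>j\<le>n. \<Sum>i\<le>n - j. g j i (n - j - i)) = (\<Sum>i\<le>n. \<Sum>j\<le>i. g j (i - j) (n - i))"
  by (simp add: sum.Sigma, rule sum.reindex_bij_witness[of _ "\<lambda>(i, j). (j, i - j)" "\<lambda>(j, i). (j +
      i, j)"]) (auto simp: add.commute)

lemma sum_triangle_swap:
  fixes g :: "nat \<Rightarrow> nat \<Rightarrow> nat \<Rightarrow> 'a::comm_monoid_add"
  shows "(\<Sum>j\<le>n. \<Sum>i\<le>n - j. g j i (n - j - i)) = (\<Sum>i\<le>n. \<Sum>j\<le>n - i. g j i (n - i - j))"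
  by (simp add: sum.Sigma, rule sum.reindex_bij_witness[of _ "\<lambda>(i, j). (j, i)" "\<lambda>(j, i). (i, j)"])
    (auto simp: add.commute)

text \<open>\<open>\<Sum>n. shift_ops a n w\<^sup>n\<close> substitutes \<open>p\<^sub>n + a\<^sub>n w\<^sup>n\<close> for \<open>p\<^sub>n\<close>.\<close>

lemma shift_ops_mult:
  "shift_ops a n (u * v) = (\<Sum>i\<le>n. shift_ops a i u * shift_ops a (n - i) v)"
proof (induction n rule: less_induct)
  case (less n)
  let ?H = "shift_ops a"
  show ?case
  proof (cases "n = 0")
    case False
    let ?g = "\<lambda>j i k. scal (of_nat j * a j) (pdiff_odd j (?H i u)) * ?H k v"
    let ?g' = "\<lambda>j i k. ?H i u * scal (of_nat j * a j) (pdiff_odd j (?H k v))"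
    have "of_nat n * ?H n (u * v) = (\<Sum>j\<le>n. \<Sum>i\<le>n - j. ?g j i (n - j - i) + ?g' j i (n - j - i))"
      unfolding shift_ops_rec[of n a "u * v"]
    proof (rule sum.cong)
      fix j assume "j \<in> {..n}"
      show "scal (of_nat j * a j) (pdiff_odd j (?H (n - j) (u * v))) =
        (\<Sum>i\<le>n - j. ?g j i (n - j - i) + ?g' j i (n - j - i))"
      proof (cases "j = 0")
        case False
        with \<open>n \<noteq> 0\<close> have "n - j < n" by simp
        then show ?thesis
          by (simp only:
              less pdiff_odd_sum pdiff_odd_mult scal_sum_right scal_add_right scal_mult mult_scal)
      qed simp
    qed simp
    \<comment> \<open>Regrouping by the degree spent on each factor: in \<open>?g\<close> the
      derivative acts on \<open>u\<close>, so j joins the degree of \<open>u\<close>; in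
      \<open>?g'\<close> it joins that of \<open>v\<close>. The recursions of the two factors then
      contribute i and n - i, together n.\<close>
    also have "\<dots> = (\<Sum>i\<le>n. \<Sum>j\<le>i. ?g j (i - j) (n - i)) + (\<Sum>i\<le>n. \<Sum>j\<le>n - i. ?g' j i (n - i - j))"
      by (simp only: sum.distrib sum_triangle_assoc[of ?g] sum_triangle_swap[of ?g'])
    also have "\<dots> = (\<Sum>i\<le>n. of_nat i * ?H i u * ?H (n - i) v + ?H i u * (of_nat (n - i) * ?H (n -
        i) v))"
      by (simp only: shift_ops_rec sum.distrib sum_distrib_left sum_distrib_right)
    also have "\<dots> = (\<Sum>i\<le>n. of_nat n * (?H i u * ?H (n - i) v))"
      by (rule sum.cong) (auto simp: of_nat_diff algebra_simps)
    finally have "of_nat n * ?H n (u * v) = of_nat n * (\<Sum>i\<le>n. ?H i u * ?H (n - i) v)"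
      by (simp only: sum_distrib_left)
    then show ?thesis by (rule of_nat_mult_cancel_Gam) (use False in simp)
  qed (simp add: shift_ops_0)
qed

lemma Q_mult_eq: "Q_mult = exp_odd (\<lambda>_. 1)"
  unfolding Q_mult_def exp_odd_def
  by (rule arg_cong[where f = exp_series]) (auto simp: pvar_odd_def fps_eq_iff)

text \<open>Writing -1 as 0^n - 1 puts this operator into the family c^n - 1 with c = 0, so one
  computation serves it and g^*, where c = t.\<close>

lemma Q_diff_eq: "Q_diff = shift_ops (\<lambda>n. 0 ^ n - 1)"
  unfolding Q_diff_def shift_ops_def
  by (rule arg_cong[where f = ops_exp])
    (auto simp: pdiff_odd_def fun_eq_iff scal_minus_left power_0_left elim!: oddE)

lemma g_adj_eq': "g_adj = shift_ops (\<lambda>n. tvar ^ n - 1)"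
  unfolding g_adj_eq[abs_def] shift_ops_def
  by (rule arg_cong[where f = ops_exp]) (auto simp: g_diff_def pdiff_odd_def fun_eq_iff)

section \<open>Commutation relations\<close>

text \<open>Extended by 0 to negative indices so that index shifts are unrestricted;
  \<open>Q_op_one\<close> identifies it with Q_k.1.\<close>

definition Qz :: "int \<Rightarrow> Gam" where
  "Qz k = (if k < 0 then 0 else Q_mult $ nat k)"

lemma Qz_neg: "k < 0 \<Longrightarrow> Qz k = 0"
  by (simp add: Qz_def)

lemma Qz_0: "Qz 0 = 1"
  by (simp add: Qz_def Q_mult_eq exp_odd_0)

lemma Qz_rec:
  assumes "k \<le> int N"
  shows "(\<Sum>j\<le>N. scal 2 (pvar_odd j * Qz (k - int j))) = scal (of_int k) (Qz k)"
proof (cases "k < 0")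
  case False
  then obtain n where n: "k = int n" using nonneg_int_cases by (metis not_less)
  have "scal (of_int k) (Qz k) = of_nat n * Q_mult $ n"
    by (simp add: n Qz_def scal_of_nat)
  also have "\<dots> = (\<Sum>j\<le>n. scal 2 (pvar_odd j * Qz (k - int j)))"
    by (simp add: Q_mult_eq exp_odd_rec n Qz_def nat_diff_distrib)
  also have "\<dots> = (\<Sum>j\<le>N. scal 2 (pvar_odd j * Qz (k - int j)))"
    by (rule sum.mono_neutral_left) (use assms n in \<open>auto simp: Qz_neg\<close>)
  finally show ?thesis ..
qed (simp add: Qz_neg)

text \<open>In generating series, d/dp_i multiplies Q(z) by (2/i) z^i, the derivative of the
  exponent.\<close>

lemma pdiff_odd_Qz:
  assumes "odd i"
  shows "pdiff_odd i (Qz k) = scal (2 / of_nat i) (Qz (k - int i))"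
proof (cases "k \<le> 0")
  case True
  then have "Qz k = (if k = 0 then 1 else 0)" by (simp add: Qz_0 Qz_neg)
  moreover have "k - int i < 0" using assms True by (auto elim: oddE)
  ultimately show ?thesis by (simp add: pdiff_odd_one pdiff_odd_0 Qz_neg)
next
  case False
  then obtain n where "k = int n" "n > 0" by (metis not_le zero_less_imp_eq_int)
  moreover have "n > 0 \<Longrightarrow> pdiff_odd i (Qz (int n)) = scal (2 / of_nat i) (Qz (int n - int i))"
  proof (induction n rule: less_induct)
    case (less n)
    have i0: "(of_nat i :: Qt) \<noteq> 0" using assms by (auto intro!: Nat.gr0I)
    have step: "pdiff_odd i (Qz (int n - int j)) = scal (2 / of_nat i) (Qz (int n - int i - int j))"
      if "odd j" "j \<le> n" for j
    proof (cases "j = n")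
      case True
      have "- int i < 0" using assms by (auto elim: oddE)
      with True show ?thesis by (simp add: Qz_0 pdiff_odd_one Qz_neg)
    next
      case False
      then have "n - j < n" "n - j > 0" using that by (auto elim: oddE)
      from less.IH[OF this] that show ?thesis by (simp add: of_nat_diff algebra_simps)
    qed
    have "of_nat n * pdiff_odd i (Qz (int n)) = pdiff_odd i (scal (of_nat n) (Qz (int n)))"
      by (simp add: pdiff_odd_scal flip: scal_of_nat)
    also have "\<dots> = pdiff_odd i (\<Sum>j\<le>n. scal 2 (pvar_odd j * Qz (int n - int j)))"
      by (simp add: Qz_rec)
    also have "\<dots> = (\<Sum>j\<le>n. scal 2 (pdiff_odd i (pvar_odd j) * Qz (int n - int j)) +
        scal (2 / of_nat i) (scal 2 (pvar_odd j * Qz (int n - int i - int j))))"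
      unfolding pdiff_odd_sum
    proof (rule sum.cong)
      fix j assume "j \<in> {..n}"
      then show "pdiff_odd i (scal 2 (pvar_odd j * Qz (int n - int j))) =
        scal 2 (pdiff_odd i (pvar_odd j) * Qz (int n - int j)) +
        scal (2 / of_nat i) (scal 2 (pvar_odd j * Qz (int n - int i - int j)))"
        by (cases "odd j") (simp_all add:
            pdiff_odd_scal pdiff_odd_mult scal_add_right step mult_scal pvar_odd_def pdiff_odd_0)
    qed simp
    also have "\<dots> = scal 2 (Qz (int n - int i)) +
        scal (2 / of_nat i) (scal (of_int (int n - int i)) (Qz (int n - int i)))"
    proof -
      have "(\<Sum>j\<le>n. scal 2 (pdiff_odd i (pvar_odd j) * Qz (int n - int j))) =
          (\<Sum>j\<le>n. if i = j then scal 2 (Qz (int n - int j)) else 0)"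
        by (rule sum.cong) (use assms in \<open>auto simp: pdiff_odd_pvar_odd\<close>)
      also have "\<dots> = scal 2 (Qz (int n - int i))"
        by (simp add: Qz_neg)
      finally show ?thesis
        by (simp only: sum.distrib Qz_rec[of "int n - int i" n, symmetric] scal_sum_right)
    qed
    also have "\<dots> = scal (2 + 2 / of_nat i * of_int (int n - int i)) (Qz (int n - int i))"
      by (simp add: scal_add_left)
    \<comment> \<open>Differentiating the factors p_j contributes 2, differentiating the Q
      coefficients contributes (2/i)(n - i).\<close>
    also have "2 + 2 / of_nat i * of_int (int n - int i) = of_nat n * (2 / of_nat i :: Qt)"
      using i0 by (simp add: field_simps del: of_nat_Qt_eq_0_iff)
    also have "scal \<dots> (Qz (int n - int i)) = of_nat n * scal (2 / of_nat i) (Qz (int n - int i))"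
      by (simp flip: scal_of_nat)
    finally show ?case by (rule of_nat_mult_cancel_Gam) (rule less.prems)
  qed
  ultimately show ?thesis by simp
qed

text \<open>Substituting p_n + a_n w^n for p_n multiplies Q(z) by h(zw), where h(x) = exp(sum over
  odd n of (2 a_n / n) x^n); the second assumption is the coefficient recursion of this
  exponential.\<close>

lemma shift_ops_Qz:
  assumes "h 0 = 1"
    and "\<And>n. of_nat n * h n = (\<Sum>i\<le>n. if odd i then 2 * a i * h (n - i) else 0)"
  shows "shift_ops a i (Qz k) = scal (h i) (Qz (k - int i))"
proof (induction i rule: less_induct)
  case (less i)
  show ?case
  proof (cases "i = 0")
    case False
    have "of_nat i * shift_ops a i (Qz k) =
        (\<Sum>j\<le>i. scal (if odd j then 2 * a j * h (i - j) else 0) (Qz (k - int i)))"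
      unfolding shift_ops_rec
    proof (rule sum.cong)
      fix j assume j: "j \<in> {..i}"
      show "scal (of_nat j * a j) (pdiff_odd j (shift_ops a (i - j) (Qz k))) =
          scal (if odd j then 2 * a j * h (i - j) else 0) (Qz (k - int i))"
      proof (cases "odd j")
        case True
        then have j0: "(of_nat j :: Qt) \<noteq> 0" "i - j < i" using False by
            (auto intro!: Nat.gr0I elim: oddE)
        have "pdiff_odd j (shift_ops a (i - j) (Qz k)) = scal (h (i - j) * (2 / of_nat j)) (Qz
            (k - int i))"
          using True j by (simp add: less[OF j0(2)] pdiff_odd_scal pdiff_odd_Qz of_nat_diff)
        moreover have "of_nat j * a j * (h (i - j) * (2 / of_nat j)) = 2 * a j * h (i - j)"
          using j0(1) by (simp add: field_simps del: of_nat_Qt_eq_0_iff)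
        ultimately show ?thesis using True by simp
      qed (simp add: pdiff_odd_def)
    qed simp
    also have "\<dots> = of_nat i * scal (h i) (Qz (k - int i))"
      by (simp only: assms(2) scal_scal flip: scal_sum_left scal_of_nat)
    finally show ?thesis by (rule of_nat_mult_cancel_Gam) (use False in simp)
  qed (simp add: shift_ops_0 assms(1))
qed

text \<open>The coefficients of \<open>(1 + c x) (1 - x) / ((1 - c x) (1 + x))\<close>: \<open>c = t\<close> gives the \<open>f\<^sub>i\<close> and
  \<open>c = 0\<close> the contraction of two \<open>Q\<close> series.\<close>

definition ratio_coeff :: "Qt \<Rightarrow> nat \<Rightarrow> Qt" where
  "ratio_coeff c i = (if i = 0 then 1 else 2 * (c - 1) * ((c ^ i - (- 1) ^ i) / (c + 1)))"

text \<open>The rational function has the logarithm sum over odd i of (2 (c^i - 1) / i) x^i, and the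
  recursion is its logarithmic derivative. The closed form of the coefficients divides by c + 1,
  which excludes c = -1.\<close>

lemma ratio_coeff_rec:
  assumes "c \<noteq> -1"
  shows "of_nat n * ratio_coeff c n = (\<Sum>i\<le>n. if odd i then 2 * (c ^ i - 1) * ratio_coeff c (n -
      i) else 0)"
proof -
  have c: "c + 1 \<noteq> 0" using assms by (metis add_eq_0_iff2)
  define G where "G = (\<lambda>b::Qt. Abs_fps (\<lambda>n. b ^ n))"
  have G: "G b * (1 - fps_const b * fps_X) = 1" for b
  proof (rule fps_ext)
    fix n
    have "(G b * (1 - fps_const b * fps_X)) $ n = G b $ n - b * (fps_X * G b) $ n"
      by (simp add: algebra_simps)
    then show "(G b * (1 - fps_const b * fps_X)) $ n = 1 $ n"
      by (cases n) (simp_all add: G_def)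
  qed
  let ?X = "fps_X :: Qt fps"
  let ?c = "fps_const c"
  define F where "F = Abs_fps (ratio_coeff c)"
  define D where "D = (1 - ?c * ?X) * (1 + ?X)"
  define N where "N = (1 + ?c * ?X) * (1 - ?X)"
  define A where "A = Abs_fps (\<lambda>i. if odd i then 2 * (c ^ i - 1) else 0)"
  have Gm: "G (-1) * (1 + ?X) = 1"
    using G[of "-1"] by (simp add: fps_const_neg[symmetric] del: fps_const_neg)
  \<comment> \<open>Partial fractions of N / D, with \<open>G b\<close> in the role of 1 / (1 - b
    x).\<close>
  have F: "F = 1 + fps_const (2 * (c - 1) / (c + 1)) * (G c - G (-1))"
    by (rule fps_ext) (simp add: F_def G_def ratio_coeff_def)
  have "F * D = D + fps_const (2 * (c - 1) / (c + 1)) * ((G c * (1 - ?c * ?X)) * (1 + ?X) - (G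
      (-1) * (1 + ?X)) * (1 - ?c * ?X))"
    unfolding F D_def by (simp add: algebra_simps del: fps_const_mult)
  also have "\<dots> = D + fps_const (2 * (c - 1) / (c + 1)) * (fps_const (c + 1) * ?X)"
    unfolding G Gm by (simp add: algebra_simps flip: fps_const_add)
  also have "\<dots> = D + fps_const (2 * (c - 1)) * ?X"
    using c by (simp add: mult.assoc[symmetric])
  also have "\<dots> = N"
    by (simp add:
        D_def N_def algebra_simps numeral_fps_const flip: fps_const_add fps_const_sub fps_const_mult)
  finally have FD: "F * D = N" .
  have D': "fps_deriv D = 1 - ?c - 2 * ?c * ?X" and N': "fps_deriv N = ?c - 1 - 2 * ?c * ?X"
    by (simp_all add: D_def N_def algebra_simps)
  have A: "A = G c - G (- c) - G 1 + G (-1)"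
    by (rule fps_ext) (auto simp: A_def G_def power_minus_odd)
  have "A * (D * N) = (G c * (1 - ?c * ?X)) * ((1 + ?X) * N)
      - (G (- c) * (1 - fps_const (- c) * ?X)) * (D * (1 - ?X))
      - (G 1 * (1 - fps_const 1 * ?X)) * (D * (1 + ?c * ?X))
      + (G (-1) * (1 + ?X)) * ((1 - ?c * ?X) * N)"
    unfolding A by (simp add:
        D_def N_def algebra_simps del: fps_const_mult fps_const_neg flip: fps_const_neg)
  also have "\<dots> = ?X * (D * fps_deriv N - N * fps_deriv D)"
    unfolding G Gm D' N' by (simp add: D_def N_def algebra_simps)
  finally have A: "A * (D * N) = ?X * (D * fps_deriv N - N * fps_deriv D)" .
  have "(?X * fps_deriv F) * (D * N) = F * (?X * (D * fps_deriv N - N * fps_deriv D))"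
    unfolding FD[symmetric] by (simp add: algebra_simps)
  then have "(?X * fps_deriv F) * (D * N) = (F * A) * (D * N)"
    by (simp only: A[symmetric] mult.assoc)
  \<comment> \<open>Power series over a field have no zero divisors, so the nonzero factor D N can
    be cancelled.\<close>
  moreover have "(D * N) $ 0 = 1" by (simp add: D_def N_def)
  then have "D * N \<noteq> 0" by auto
  ultimately have "?X * fps_deriv F = F * A" by simp
  then have "(?X * fps_deriv F) $ n = (A * F) $ n" by (simp add: mult.commute)
  moreover have "(?X * fps_deriv F) $ n = of_nat n * ratio_coeff c n"
    by (cases n) (simp_all add: F_def)
  moreover have "(A * F) $ n = (\<Sum>i\<le>n. if odd i then 2 * (c ^ i - 1) * ratio_coeff c (n - i) else 0)"
    unfolding fps_mult_nth atLeast0AtMost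
    by (rule sum.cong) (simp_all add: A_def F_def)
  ultimately show ?thesis by simp
qed

lemma tvar_neq: "tvar \<noteq> -1"
proof
  assume "tvar = -1"
  then have "Fract [:0, 1:] 1 = (Fract (-1) 1 :: Qt)"
    by (simp add: tvar_def One_fract_def)
  then show False by (simp add: eq_fract one_pCons)
qed

lemma Q_diff_Qz: "Q_diff i (Qz k) = scal (ratio_coeff 0 i) (Qz (k - int i))"
proof -
  have "(0::Qt) \<noteq> -1" by simp
  from shift_ops_Qz[OF _ ratio_coeff_rec[OF this]] show ?thesis by (simp add:
      Q_diff_eq ratio_coeff_def)
qed

lemma g_adj_Qz: "g_adj i (Qz k) = scal (ratio_coeff tvar i) (Qz (k - int i))"
  unfolding g_adj_eq' by (rule shift_ops_Qz[OF _ ratio_coeff_rec[OF tvar_neq]]) (simp add: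
      ratio_coeff_def)

section \<open>The operators Q_n as finite sums\<close>

lemma Q_diff_bound: obtains J where "\<And>j. j > J \<Longrightarrow> Q_diff j u = 0"
proof -
  obtain J where "\<forall>j\<in>{j. Q_diff j u \<noteq> 0}. j \<le> J"
    using Q_diff_finite[of u] by (meson finite_nat_set_iff_bounded_le)
  then have "\<not> J < j" if "Q_diff j u \<noteq> 0" for j using that by auto
  then show ?thesis by (intro that[of J]) blast
qed

lemma Q_op_eq:
  assumes "\<And>j. j > J \<Longrightarrow> Q_diff j u = 0"
  shows "Q_op n u = (\<Sum>j\<le>J. Qz (n + int j) * Q_diff j u)"
proof -
  have "Q_op n u = Sum_any (\<lambda>j. Qz (n + int j) * Q_diff j u)"
    unfolding Q_op_def by (rule Sum_any.cong) (simp add: Qz_def)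
  also have "\<dots> = (\<Sum>j\<le>J. Qz (n + int j) * Q_diff j u)"
    by (rule Sum_any.expand_superset) (use assms in \<open>auto simp: not_less[symmetric]\<close>)
  finally show ?thesis .
qed

lemma Q_op_add: "Q_op n (u + v) = Q_op n u + Q_op n v"
proof -
  obtain J where J: "\<And>j. j > J \<Longrightarrow> Q_diff j u = 0"
    using Q_diff_bound[of u] by blast
  obtain K where K: "\<And>j. j > K \<Longrightarrow> Q_diff j v = 0"
    using Q_diff_bound[of v] by blast
  have add: "Q_diff j (u + v) = Q_diff j u + Q_diff j v" for j
    by (simp add: Q_diff_eq shift_ops_add)
  show ?thesis
    by (subst (1 2 3) Q_op_eq[of "max J K"]) (simp_all add: J K add distrib_left sum.distrib)
qed

lemma Q_op_scal: "Q_op n (scal c u) = scal c (Q_op n u)"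
proof -
  obtain J where J: "\<And>j. j > J \<Longrightarrow> Q_diff j u = 0"
    using Q_diff_bound[of u] by blast
  have scal: "Q_diff j (scal c u) = scal c (Q_diff j u)" for j
    by (simp add: Q_diff_eq shift_ops_scal)
  show ?thesis
    by (subst (1 2) Q_op_eq[of J]) (simp_all add: J scal mult_scal scal_sum_right)
qed

lemma Q_op_0: "Q_op n 0 = 0"
  using Q_op_scal[of n 0 0] by simp

lemma Q_op_minus: "Q_op n (- u) = - Q_op n u"
  using Q_op_scal[of n "-1" u] by (simp add: scal_minus_left)

lemma Q_op_sum: "Q_op n (\<Sum>i\<in>I. f i) = (\<Sum>i\<in>I. Q_op n (f i))"
  by (induction I rule: infinite_finite_induct) (simp_all add: Q_op_add Q_op_0)

lemma shift_ops_one: "shift_ops a n 1 = (if n = 0 then 1 else 0)"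
proof (induction n rule: less_induct)
  case (less n)
  show ?case
  proof (cases "n = 0")
    case False
    have "of_nat n * shift_ops a n 1 = (\<Sum>i\<le>n. 0)"
      unfolding shift_ops_rec
    proof (rule sum.cong)
      fix i assume "i \<in> {..n}"
      then show "scal (of_nat i * a i) (pdiff_odd i (shift_ops a (n - i) 1)) = 0"
        using False by (cases "i = 0") (simp_all add: less pdiff_odd_one pdiff_odd_0)
    qed simp
    then show ?thesis
      using of_nat_mult_cancel_Gam[of n "shift_ops a n 1" 0] False by simp
  qed (simp add: shift_ops_0)
qed

lemma Q_op_one: "Q_op n 1 = Qz n"
  by (subst Q_op_eq[of 0]) (simp_all add: Q_diff_eq shift_ops_one shift_ops_0)

lemma g_adj_one: "g_adj k 1 = (if k = 0 then 1 else 0)"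
  by (simp add: g_adj_eq' shift_ops_one)

text \<open>The shift is multiplicative, commutes with the differential half of Q_n and acts on Q(z)
  through the f_i.\<close>

lemma g_adj_Q_op: "g_adj k (Q_op n u) = (\<Sum>i\<le>k. scal (ratio_coeff tvar i) (Q_op (n - int i) (g_adj
    (k - i) u)))"
proof -
  obtain J where J: "\<And>j. j > J \<Longrightarrow> Q_diff j u = 0"
    using Q_diff_bound[of u] by blast
  have comm: "g_adj i (Q_diff j v) = Q_diff j (g_adj i v)" for i j v
    by (simp add: g_adj_eq' Q_diff_eq shift_ops_commute)
  \<comment> \<open>By commutation the bound \<open>J\<close> for \<open>u\<close> serves every
    g^*_i u as well.\<close>
  have Jg: "Q_diff j (g_adj i u) = 0" if "j > J" for i j
    using J[OF that] by (simp only: comm[symmetric]) (simp add: g_adj_eq' shift_ops_zero)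
  have mult: "g_adj k (v * w) = (\<Sum>i\<le>k. g_adj i v * g_adj (k - i) w)" for v w
    by (simp add: g_adj_eq' shift_ops_mult)
  have sum: "g_adj k (\<Sum>i\<in>I. f i) = (\<Sum>i\<in>I. g_adj k (f i))" for I :: "nat set" and f
    by (simp add: g_adj_eq' shift_ops_sum)
  have Qu: "Q_op n u = (\<Sum>j\<le>J. Qz (n + int j) * Q_diff j u)"
    by (rule Q_op_eq) (rule J)
  have "g_adj k (Q_op n u) =
      (\<Sum>j\<le>J. \<Sum>i\<le>k. scal (ratio_coeff tvar i) (Qz (n + int j - int i) * Q_diff j (g_adj (k - i) u)))"
    unfolding Qu sum mult by (simp add: g_adj_Qz comm scal_mult)
  also have "\<dots> = (\<Sum>i\<le>k. scal (ratio_coeff tvar i) (Q_op (n - int i) (g_adj (k - i) u)))"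
    by (subst sum.swap) (simp add: Q_op_eq[OF Jg] scal_sum_right algebra_simps)
  finally show ?thesis .
qed

section \<open>The Clifford relations\<close>

definition parity_sign :: "int \<Rightarrow> 'a::comm_ring_1" where
  "parity_sign k = (if even k then 1 else - 1)"

lemma parity_sign_minus [simp]: "parity_sign (- a) = parity_sign a"
  by (simp add: parity_sign_def)

lemma parity_sign_of_nat: "parity_sign (int n) = (-1) ^ n"
  by (simp add: parity_sign_def)

text \<open>A coefficient of Q(-z) Q(z) = 1. Nonzero summands need -a <= l <= b, and the window
  contains this range.\<close>

lemma Q_mult_neg: 
  assumes "\<bar>a\<bar> \<le> int L" "\<bar>b\<bar> \<le> int L"
  shows "(\<Sum>l\<in>{- int L..int L}. parity_sign l * Qz (a + l) * Qz (b - l)) = (if a + b =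
      0 then parity_sign a else 0)"
proof (cases "a + b < 0")
  case True
  then have "a + l < 0 \<or> b - l < 0" for l by linarith
  then have "parity_sign l * Qz (a + l) * Qz (b - l) = 0" for l
    by (metis Qz_neg mult_zero_left mult_zero_right)
  with True show ?thesis by (simp only: sum.neutral_const) simp
next
  case False
  define r where "r = nat (a + b)"
  have "(\<Sum>l\<in>{- int L..int L}. parity_sign l * Qz (a + l) * Qz (b - l)) =
      (\<Sum>l\<in>{- a..b}. parity_sign l * Qz (a + l) * Qz (b - l))"
    by (rule sum.mono_neutral_right) (use assms in \<open>auto simp: Qz_neg not_le\<close>)
  also have "\<dots> = (\<Sum>p\<le>r. parity_sign a * ((-1) ^ p * Q_mult $ p * Q_mult $ (r - p)))"
  proof (rule sum.reindex_bij_witness[of _ "\<lambda>p. int p - a" "\<lambda>l. nat (a + l)"])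
    fix l assume l: "l \<in> {- a..b}"
    then have "parity_sign l = (parity_sign a * (-1) ^ nat (a + l) :: Gam)"
      by (auto simp: parity_sign_def even_nat_iff minus_one_power_iff)
    moreover have "nat (b - l) = r - nat (a + l)" using l by (auto simp: r_def nat_diff_distrib)
    ultimately show "parity_sign a * ((-1) ^ nat (a + l) * Q_mult $ nat (a + l) * Q_mult $ (r -
        nat (a + l))) =
        parity_sign l * Qz (a + l) * Qz (b - l)"
      using l by (simp add: Qz_def mult.assoc)
  qed (use False in \<open>auto simp: r_def\<close>)
  also have "\<dots> = (if r = 0 then parity_sign a else 0)"
    by (simp add: Q_mult_eq exp_odd_neg flip: sum_distrib_left)
  finally show ?thesis using False by (simp add: r_def)
qed

text \<open>The adjoint of E(-w) E(w) = 1.\<close>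

lemma Q_diff_neg:
  "(\<Sum>p\<le>r. scal ((-1) ^ p) (Q_diff p (Q_diff (r - p) u))) = (if r = 0 then u else 0)"
proof -
  let ?a = "\<lambda>n. 0 ^ n - 1 :: Qt"
  have sc: "scal ((-1) ^ p) x = (-1) ^ p * x" for p x
    by (cases "even p") (simp_all add: scal_minus_left)
  have "mult_adj (\<Sum>p\<le>r. scal ((-1) ^ p) (exp_odd ?a $ (r - p) * exp_odd ?a $ p))
      (\<lambda>u. \<Sum>p\<le>r. scal ((-1) ^ p) (Q_diff p (Q_diff (r - p) u)))"
    unfolding Q_diff_eq by (intro mult_adj_lincomb) (simp add: mult.commute[of "exp_odd ?a $ (r -
        _)"] mult_adj_compose mult_adj_shift_ops shift_ops_commute[of ?a _ ?a "r - _"])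
  moreover have "mult_adj (\<Sum>p\<le>r. scal ((-1) ^ p) (exp_odd ?a $ (r - p) * exp_odd ?a $ p))
      (\<lambda>u. if r = 0 then u else 0)"
    using exp_odd_neg[of ?a r] by (simp add: sc mult_adj_def mult.commute mult.left_commute)
  ultimately show ?thesis by (rule mult_adj_unique)
qed

lemma sum_triangle_rect:
  fixes g :: "nat \<Rightarrow> nat \<Rightarrow> 'a::comm_monoid_add"
  assumes "\<And>l p. l > L \<or> p > J \<Longrightarrow> g l p = 0"
  shows "(\<Sum>j\<le>J + L. \<Sum>l\<le>j. g l (j - l)) = (\<Sum>l\<le>L. \<Sum>p\<le>J. g l p)"
proof -
  have "(\<Sum>j\<le>J + L. \<Sum>l\<le>j. g l (j - l)) = (\<Sum>(l, p)\<in>{(l, p). l + p \<le> J + L}. g l p)"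
    by (simp add: sum.Sigma, rule sum.reindex_bij_witness[of _ "\<lambda>(l, p). (l + p, l)" "\<lambda>(j, l).
        (l, j - l)"]) auto
  also have "\<dots> = (\<Sum>(l, p)\<in>{..L} \<times> {..J}. g l p)"
  proof (rule sum.mono_neutral_right)
    show "finite {(l, p). l + p \<le> J + L}"
      by (rule finite_subset[of _ "{..J + L} \<times> {..J + L}"]) auto
  next
    show "\<forall>x\<in>{(l, p). l + p \<le> J + L} - {..L} \<times> {..J}. (case x of (l, p) \<Rightarrow> g l p) = 0"
      by (auto simp: not_le intro!: assms)
  qed auto
  finally show ?thesis by (simp add: sum.cartesian_product)
qed

text \<open>Moving the differential halves to the right costs the series (1 - x)/(1 + x). The
  opposite order completes its coefficients to 2 (-1)^l over all integers l; then Q(z) Q(-z) = 1 and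
  its adjoint evaluate the sum.\<close>

theorem Q_op_anticommute:
  "Q_op m (Q_op n u) + Q_op n (Q_op m u) = (if m + n = 0 then scal (2 * parity_sign m) u else 0)"
proof -
  obtain J where J: "\<And>j. j > J \<Longrightarrow> Q_diff j u = 0"
    using Q_diff_bound[of u] by blast
  have mult: "Q_diff k (v * w) = (\<Sum>i\<le>k. Q_diff i v * Q_diff (k - i) w)" for k v w
    by (simp add: Q_diff_eq shift_ops_mult)
  have sum: "Q_diff k (\<Sum>i\<in>I. f i) = (\<Sum>i\<in>I. Q_diff k (f i))" for k and I :: "nat set" and f
    by (simp add: Q_diff_eq shift_ops_sum)
  have comm: "Q_diff i (Q_diff j v) = Q_diff j (Q_diff i v)" for i j v
    by (simp add: Q_diff_eq shift_ops_commute)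
  have zero: "Q_diff i 0 = 0" for i by (simp add: Q_diff_eq shift_ops_zero)
  have JJ: "Q_diff p (Q_diff i u) = 0" if "p > J \<or> i > J" for p i
    using that J comm[of p i u] by (auto simp: zero)
  \<comment> \<open>The normally ordered product. It is symmetric in a and b because the
    multiplications commute and so do the differential halves.\<close>
  define N where "N a b = (\<Sum>i\<le>J. \<Sum>p\<le>J. Qz (a + int p) * Qz (b + int i) * Q_diff p
      (Q_diff i u))" for a b
  \<comment> \<open>Large enough to bound |m + p| and |n + i| for i, p <= J, and to make n + i - l
    negative for l > L.\<close>
  define L where "L = nat \<bar>m\<bar> + nat \<bar>n\<bar> + J"
  have N_sym: "N a b = N b a" for a b
    unfolding N_def by (subst sum.swap) (simp add: comm mult.commute mult.left_commute)
  have prod: "Q_op m (Q_op n u) = (\<Sum>l\<le>L. scal (ratio_coeff 0 l) (N (m + int l) (n - int l)))"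
    if L: "nat \<bar>m\<bar> + nat \<bar>n\<bar> + J \<le> L" for m n
  proof -
    let ?g = "\<lambda>l p. \<Sum>i\<le>J. scal (ratio_coeff 0 l) (Qz (m + int l + int p) * Qz (n + int i -
        int l) * Q_diff p (Q_diff i u))"
    have D: "Q_diff j (Q_op n u) = (\<Sum>i\<le>J. \<Sum>l\<le>j. scal (ratio_coeff 0 l) (Qz (n + int i - int l) *
        Q_diff (j - l) (Q_diff i u)))" for j
      by (simp add: Q_op_eq[OF J] sum mult Q_diff_Qz scal_mult)
    have g0: "scal (ratio_coeff 0 l) (Qz (n + int i - int l) * Q_diff p (Q_diff i u)) = 0"
      if "l > L \<or> p > J" "i \<le> J" for l p i
      using that L JJ by (auto simp: Qz_neg)
    have "Q_diff j (Q_op n u) = 0" if "j > J + L" for j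
      unfolding D using that by (intro sum.neutral ballI g0) auto
    then have "Q_op m (Q_op n u) = (\<Sum>j\<le>J + L. Qz (m + int j) * Q_diff j (Q_op n u))"
      by (rule Q_op_eq)
    also have "\<dots> = (\<Sum>j\<le>J + L. \<Sum>l\<le>j. ?g l (j - l))"
      unfolding D
      by (subst sum.swap) (simp add: sum_distrib_left mult_scal scal_mult algebra_simps of_nat_diff)
    also have "\<dots> = (\<Sum>l\<le>L. \<Sum>p\<le>J. ?g l p)"
    proof (rule sum_triangle_rect)
      fix l p assume "l > L \<or> p > J"
      then show "?g l p = 0"
        using g0[of l p] by (intro sum.neutral) (simp add: mult.assoc flip: mult_scal)
    qed
    also have "\<dots> = (\<Sum>l\<le>L. scal (ratio_coeff 0 l) (N (m + int l) (n - int l)))"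
      unfolding N_def scal_sum_right
      by (subst sum.swap[of _ "{..J}" "{..J}"]) (simp add: algebra_simps)
    finally show ?thesis .
  qed
  have "Q_op m (Q_op n u) + Q_op n (Q_op m u) =
      (\<Sum>l\<le>L. scal (ratio_coeff 0 l) (N (m + int l) (n - int l))) + (\<Sum>l\<le>L. scal (ratio_coeff 0 l)
          (N (m - int l) (n + int l)))"
    using prod[of m n] prod[of n m] by (simp add: L_def N_sym[of "n + _"] add.commute)
  also have "\<dots> = (\<Sum>l\<in>{- int L..int L}. scal (2 * parity_sign l) (N (m + l) (n - l)))"
  proof -
    let ?G = "\<lambda>l. scal (2 * parity_sign l) (N (m + l) (n - l))"
    have ratio_coeff: "ratio_coeff 0 l = 2 * parity_sign (int l)" if "l > 0" for l
      using that by (simp add: ratio_coeff_def parity_sign_of_nat)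
    have pos: "(\<Sum>l\<le>L. scal (ratio_coeff 0 l) (N (m + int l) (n - int l))) = N m n +
        (\<Sum>l\<in>{1..int L}. ?G l)"
    proof -
      have "(\<Sum>l\<in>{1..int L}. ?G l) = (\<Sum>l=1..L. scal (ratio_coeff 0 l) (N (m + int l) (n - int l)))"
        by (rule sum.reindex_bij_witness[of _ int nat]) (auto simp: ratio_coeff)
      then show ?thesis
        by (simp add: sum.atLeast_Suc_atMost[of 0] ratio_coeff_def flip: atLeast0AtMost)
    qed
    have neg: "(\<Sum>l\<le>L. scal (ratio_coeff 0 l) (N (m - int l) (n + int l))) = N m n +
        (\<Sum>l\<in>{- int L..-1}. ?G l)"
    proof -
      have "(\<Sum>l\<in>{- int L..-1}. ?G l) = (\<Sum>l=1..L. scal (ratio_coeff 0 l) (N (m - int l) (n +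
          int l)))"
        by (rule sum.reindex_bij_witness[of _ "\<lambda>l. - int l" "\<lambda>l. nat (- l)"])
            (auto simp: ratio_coeff)
      then show ?thesis
        by (simp add: sum.atLeast_Suc_atMost[of 0] ratio_coeff_def flip: atLeast0AtMost)
    qed
    have "{- int L..int L} = {- int L..-1} \<union> ({0} \<union> {1..int L})" by auto
    then have "(\<Sum>l\<in>{- int L..int L}. ?G l) = (\<Sum>l\<in>{- int L..-1}. ?G l) + (?G 0 +
        (\<Sum>l\<in>{1..int L}. ?G l))"
      by (simp add: sum.union_disjoint)
    \<comment> \<open>The leading coefficient 1 occurs once in each order, which supplies the 2 at l
      = 0.\<close>
    moreover have "?G 0 = N m n + N m n"
      by (simp add: parity_sign_def flip: scal_add_left[of 1 1, simplified])
    ultimately show ?thesis unfolding pos neg by (simp add: algebra_simps)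
  qed
  also have "\<dots> = (\<Sum>i\<le>J. \<Sum>p\<le>J. scal 2 ((\<Sum>l\<in>{- int L..int L}. parity_sign l * Qz (m + int p + l) *
      Qz (n + int i - l)) * Q_diff p (Q_diff i u)))"
  proof -
    have sc: "scal (2 * parity_sign l) x = scal 2 (parity_sign l * x)" for l x
      by (simp add: parity_sign_def scal_minus_left scal_minus_right)
    show ?thesis
      unfolding N_def sc sum_distrib_left sum_distrib_right scal_sum_right
      by (subst sum.swap, rule sum.cong[OF refl], subst sum.swap) (simp add: algebra_simps)
  qed
  also have "\<dots> = (\<Sum>i\<le>J. \<Sum>p\<le>J. if m + n + int p + int i = 0 then scal (2 * parity_sign m) (scal
      ((-1) ^ p) (Q_diff p (Q_diff i u))) else 0)"
  proof (intro sum.cong refl)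
    fix i p assume "i \<in> {..J}" "p \<in> {..J}"
    then have "(\<Sum>l\<in>{- int L..int L}. parity_sign l * Qz (m + int p + l) * Qz (n + int i - l)) =
      (if m + int p + (n + int i) = 0 then parity_sign (m + int p) else 0)"
      by (intro Q_mult_neg) (auto simp: L_def)
    moreover have "scal 2 (parity_sign (m + int p) * x) = scal (2 * parity_sign m) (scal
        ((-1) ^ p) x)" for x
      by (simp add: parity_sign_def scal_minus_left scal_minus_right)
    moreover have "m + int p + (n + int i) = 0 \<longleftrightarrow> m + n + int p + int i = 0" by linarith
    ultimately show "scal 2 ((\<Sum>l\<in>{- int L..int L}. parity_sign l * Qz (m + int p + l) * Qz (n +
        int i - l)) * Q_diff p (Q_diff i u))
      = (if m + n + int p + int i = 0 then scal (2 * parity_sign m) (scal ((-1) ^ p) (Q_diff p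
          (Q_diff i u))) else 0)"
      by (simp del: scal_scal)
  qed
  \<comment> \<open>Only the pairs with p + i = -(m + n) remain, and their alternating sum is
    \<open>Q_diff_neg\<close>.\<close>
  also have "\<dots> = (if m + n = 0 then scal (2 * parity_sign m) u else 0)"
  proof (cases "m + n > 0")
    case False
    define r where "r = nat (- (m + n))"
    have r: "m + n + int p + int i = 0 \<longleftrightarrow> p + i = r" for p i
      using False by (auto simp: r_def)
    let ?h = "\<lambda>i p. scal ((-1) ^ p) (Q_diff p (Q_diff i u))"
    have "(\<Sum>i\<le>J. \<Sum>p\<le>J. if p + i = r then scal (2 * parity_sign m) (?h i p) else 0) =
        (\<Sum>(i, p)\<in>{..J} \<times> {..J}. if p + i = r then scal (2 * parity_sign m) (?h i p) else 0)"
      by (simp add: sum.cartesian_product)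
    also have "\<dots> = (\<Sum>(i, p)\<in>{(i, p). p + i = r}. scal (2 * parity_sign m) (?h i p))"
    proof (rule sum.mono_neutral_cong)
      show "finite {(i, p). p + i = r}"
        by (rule finite_subset[of _ "{..r} \<times> {..r}"]) auto
    next
      fix x assume "x \<in> {(i, p). p + i = r} - {..J} \<times> {..J}"
      then have "Q_diff (snd x) (Q_diff (fst x) u) = 0" by (intro JJ) auto
      then show "(case x of (i, p) \<Rightarrow> scal (2 * parity_sign m) (?h i p)) = 0"
        by (simp add: case_prod_beta)
    qed auto
    also have "\<dots> = (\<Sum>p\<le>r. scal (2 * parity_sign m) (?h (r - p) p))"
      by (rule sum.reindex_bij_witness[of _ "\<lambda>p. (r - p, p)" "\<lambda>(i, p). p"]) auto
    also have "\<dots> = (if r = 0 then scal (2 * parity_sign m) u else 0)"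
      by (simp add: Q_diff_neg del: scal_scal flip: scal_sum_right)
    finally show ?thesis using False by (simp add: r) (auto simp: r_def)
  qed (auto intro!: sum.neutral)
  finally show ?thesis .
qed

section \<open>Expansion of the Pfaffian along the first row\<close>

definition matchings :: "nat \<Rightarrow> (nat \<Rightarrow> nat) set" where
  "matchings N = {\<sigma>. \<sigma> permutes {..<2 * N} \<and> (\<forall>i<N. \<sigma> (2 * i) < \<sigma> (2 * i + 1)) \<and>
     (\<forall>j. j + 1 < N \<longrightarrow> \<sigma> (2 * j) < \<sigma> (2 * (j + 1)))}"

lemma matchingsD:
  assumes "\<sigma> \<in> matchings N"
  shows "\<sigma> permutes {..<2 * N}" "i < N \<Longrightarrow> \<sigma> (2 * i) < \<sigma> (2 * i + 1)"
    "j + 1 < N \<Longrightarrow> \<sigma> (2 * j) < \<sigma> (2 * (j + 1))"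
  using assms unfolding matchings_def by blast+

text \<open>The entries are a function of two indices, so passing to a minor is a
  relabelling.\<close>

definition pf :: "nat \<Rightarrow> (nat \<Rightarrow> nat \<Rightarrow> 'a::comm_ring_1) \<Rightarrow> 'a" where
  "pf N a = (\<Sum>\<sigma>\<in>matchings N. of_int (sign \<sigma>) * (\<Prod>i<N. a (\<sigma> (2 * i)) (\<sigma> (2 * i + 1))))"

lemma pf_0: "pf 0 a = 1"
proof -
  have "matchings 0 = {id}" by (auto simp: matchings_def)
  then show ?thesis by (simp add: pf_def)
qed

lemma pf_cong:
  assumes "\<And>x y. x < y \<Longrightarrow> y < 2 * N \<Longrightarrow> a x y = b x y"
  shows "pf N a = pf N b"
  unfolding pf_def
proof (intro sum.cong refl arg_cong2[where f = times] prod.cong)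
  fix \<sigma> i assume \<sigma>: "\<sigma> \<in> matchings N" and i: "i \<in> {..<N}"
  have "\<sigma> (2 * i + 1) \<in> {..<2 * N}"
    using matchingsD(1)[OF \<sigma>] i permutes_in_image[of \<sigma> "{..<2 * N}" "2 * i + 1"] by simp
  then show "a (\<sigma> (2 * i)) (\<sigma> (2 * i + 1)) = b (\<sigma> (2 * i)) (\<sigma> (2 * i + 1))"
    using matchingsD(2)[OF \<sigma>, of i] i by (intro assms) auto
qed

text \<open>The matching that pairs \<open>0\<close> with \<open>j + 1\<close> and the remaining points as \<open>q\<close> does.\<close>

definition insert_pair :: "nat \<Rightarrow> (nat \<Rightarrow> nat) \<Rightarrow> nat \<Rightarrow> nat" where
  "insert_pair j q = permutation_insert 0 0 (permutation_insert 0 j q)"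

lemma insert_pair_simps:
  "insert_pair j q 0 = 0"
  "insert_pair j q (Suc 0) = Suc j"
  "insert_pair j q (Suc (Suc x)) = Suc (insert_index j (q x))"
  by (simp_all add: insert_pair_def permutation_insert_expand insert_index_def)

lemma insert_index_less_iff: "insert_index j x < insert_index j y \<longleftrightarrow> x < y"
  by (auto simp: insert_index_def)

text \<open>\<open>insert_index\<close> preserves the order of the values of \<open>q\<close>, and
  the new first pair begins with 0, below all others.\<close>

lemma insert_pair_mem_iff:
  assumes q: "q permutes {..<2 * N}" and j: "j < 2 * N + 1"
  shows "insert_pair j q \<in> matchings (Suc N) \<longleftrightarrow> q \<in> matchings N"
proof -
  let ?\<sigma> = "insert_pair j q"
  have perm: "?\<sigma> permutes {..<2 * Suc N}"
    using permutation_insert_permutes[OF permutation_insert_permutes[of q "2 * N" 0 j], of 0 0] q j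
    by (simp add: insert_pair_def atLeast0LessThan)
  have 1: "(\<forall>i<Suc N. ?\<sigma> (2 * i) < ?\<sigma> (2 * i + 1)) \<longleftrightarrow> (\<forall>i<N. q (2 * i) < q (2 * i + 1))"
    by (simp add: All_less_Suc2 insert_pair_simps insert_index_less_iff)
  have 2: "(\<forall>i. i + 1 < Suc N \<longrightarrow> ?\<sigma> (2 * i) < ?\<sigma> (2 * (i + 1))) \<longleftrightarrow> (\<forall>i. i + 1 < N \<longrightarrow> q (2 * i) < q
      (2 * (i + 1)))"
    (is "?L \<longleftrightarrow> ?R")
  proof
    assume L: ?L
    show ?R
    proof (intro allI impI)
      fix i assume "i + 1 < N"
      then show "q (2 * i) < q (2 * (i + 1))"
        using L[rule_format, of "Suc i"] by (simp add: insert_pair_simps insert_index_less_iff)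
    qed
  next
    assume R: ?R
    show ?L
    proof (intro allI impI)
      fix i assume "i + 1 < Suc N"
      then show "?\<sigma> (2 * i) < ?\<sigma> (2 * (i + 1))"
        using R[rule_format, of "i - 1"]
        by (cases i) (simp_all add: insert_pair_simps insert_index_less_iff numeral_2_eq_2)
    qed
  qed
  show ?thesis unfolding matchings_def mem_Collect_eq 1 2 using perm q by blast
qed

text \<open>The left ends of the pairs increase and each lies below its partner, so the value at 0
  is the least of all.\<close>

lemma matchings_fix_0:
  assumes "\<sigma> \<in> matchings (Suc N)"
  shows "\<sigma> 0 = 0"
proof -
  note perm = matchingsD(1)[OF assms]
  have even: "\<sigma> 0 \<le> \<sigma> (2 * i)" if "i < Suc N" for i
    using that
  proof (induction i)
    case (Suc i)
    then have "\<sigma> (2 * i) < \<sigma> (2 * (i + 1))"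
      by (intro matchingsD(3)[OF assms]) simp
    with Suc show ?case by simp
  qed simp
  have le: "\<sigma> 0 \<le> \<sigma> x" if "x < 2 * Suc N" for x
  proof (cases "even x")
    case True
    then show ?thesis using even[of "x div 2"] that by auto
  next
    case False
    then obtain y where y: "x = 2 * y + 1" by (auto elim: oddE)
    with that have "y < Suc N" by simp
    then have "\<sigma> (2 * y) < \<sigma> x" unfolding y by (rule matchingsD(2)[OF assms])
    with even[OF \<open>y < Suc N\<close>] show ?thesis by simp
  qed
  obtain x where "x < 2 * Suc N" "\<sigma> x = 0"
    using permutes_surj[OF perm] permutes_in_image[OF perm]
    by (metis lessThan_iff surjD zero_less_Suc mult_pos_pos zero_less_numeral)
  with le[of x] show ?thesis by simp
qed

text \<open>The inverse deletes the fixed point 0 and then its partner.\<close>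

lemma insert_pair_bij:
  "bij_betw (\<lambda>(j, q). insert_pair j q) ({..<2 * N + 1} \<times> matchings N) (matchings (Suc N))"
  unfolding bij_betw_def
proof
  show "inj_on (\<lambda>(j, q). insert_pair j q) ({..<2 * N + 1} \<times> matchings N)"
  proof (rule inj_onI)
    fix z z'
    assume "(\<lambda>(j, q). insert_pair j q) z = (\<lambda>(j, q). insert_pair j q) z'"
    then obtain j q j' q' where z: "z = (j, q)" "z' = (j', q')"
      and eq: "insert_pair j q = insert_pair j' q'"
      by (cases z, cases z') auto
    have "j = j'" using fun_cong[OF eq, of "Suc 0"] by (simp add: insert_pair_simps)
    moreover have "q x = q' x" for x
      using fun_cong[OF eq, of "Suc (Suc x)"] \<open>j = j'\<close> insert_index_less_iff[of j "q x" "q' x"]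
        insert_index_less_iff[of j "q' x" "q x"]
      by (simp add: insert_pair_simps)
    ultimately show "z = z'" unfolding z by auto
  qed
  show "(\<lambda>(j, q). insert_pair j q) ` ({..<2 * N + 1} \<times> matchings N) = matchings (Suc N)"
  proof (intro equalityI subsetI)
    fix \<sigma> assume "\<sigma> \<in> (\<lambda>(j, q). insert_pair j q) ` ({..<2 * N + 1} \<times> matchings N)"
    then show "\<sigma> \<in> matchings (Suc N)"
      using insert_pair_mem_iff matchingsD(1) by fastforce
  next
    fix \<sigma> assume \<sigma>: "\<sigma> \<in> matchings (Suc N)"
    from matchingsD(1)[OF this] have "\<sigma> permutes {0..<Suc (2 * N + 1)}"
      by (simp add: atLeast0LessThan)
    then obtain p where p: "p permutes {0..<2 * N + 1}" "\<sigma> = permutation_insert 0 0 p"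
      using permutation_fix[of 0 "2 * N + 1" 0] matchings_fix_0[OF \<sigma>] by auto
    have p0: "p 0 < Suc (2 * N)" using permutes_in_image[OF p(1), of 0] by simp
    then obtain q where q: "q permutes {0..<2 * N}" "p = permutation_insert 0 (p 0) q"
      using permutation_fix[of 0 "2 * N" "p 0"] p(1) by auto
    then have "\<sigma> = insert_pair (p 0) q" by (metis p(2) insert_pair_def)
    then show "\<sigma> \<in> (\<lambda>(j, q). insert_pair j q) ` ({..<2 * N + 1} \<times> matchings N)"
      using \<sigma> p0 q(1) insert_pair_mem_iff[of q N "p 0"] by (auto simp: atLeast0LessThan)
  qed
qed

text \<open>The sign comes from inserting 0 -> j into \<open>q\<close>; the second insertion, 0 ->
  0, leaves it unchanged.\<close>

lemma pf_Suc:
  "pf (Suc N) a = (\<Sum>j<2 * N + 1. (-1) ^ j * a 0 (Suc j) *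
     pf N (\<lambda>x y. a (Suc (insert_index j x)) (Suc (insert_index j y))))"
proof -
  have "pf (Suc N) a = (\<Sum>(j, q)\<in>{..<2 * N + 1} \<times> matchings N. of_int (sign (insert_pair j q)) *
      (\<Prod>i<Suc N. a (insert_pair j q (2 * i)) (insert_pair j q (2 * i + 1))))"
    unfolding pf_def sum.reindex_bij_betw[OF insert_pair_bij, symmetric]
    by (simp add: case_prod_beta)
  also have "\<dots> = (\<Sum>(j, q)\<in>{..<2 * N + 1} \<times> matchings N. (-1) ^ j * a 0 (Suc j) *
      (of_int (sign q) * (\<Prod>i<N. a (Suc (insert_index j (q (2 * i)))) (Suc (insert_index j (q (2 *
          i + 1)))))))"
  proof (rule sum.cong[OF refl], unfold split_paired_all split_conv mem_Times_iff fst_conv snd_conv, elim conjE)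
    fix j q assume j: "j \<in> {..<2 * N + 1}" and "q \<in> matchings N"
    then have q: "q permutes {0..<2 * N}" unfolding atLeast0LessThan by (intro matchingsD(1))
    have "(of_int (sign (insert_pair j q)) :: 'a) = (-1) ^ j * of_int (sign q)"
      using signof_permutation_insert[OF q, of 0 j, where 'a = 'a]
        signof_permutation_insert[OF permutation_insert_permutes[OF q, of 0 j], of 0 0, where 'a =
            'a] j
      by (simp add: insert_pair_def)
    then show "of_int (sign (insert_pair j q)) *
      (\<Prod>i<Suc N. a (insert_pair j q (2 * i)) (insert_pair j q (2 * i + 1))) = (-1) ^ j * a 0
          (Suc j) *
      (of_int (sign q) * (\<Prod>i<N. a (Suc (insert_index j (q (2 * i)))) (Suc (insert_index j (q (2 *
          i + 1))))))"
      by (simp add: prod.lessThan_Suc_shift insert_pair_simps mult_ac del: prod.lessThan_Suc)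
  qed
  also have "\<dots> = (\<Sum>j<2 * N + 1. (-1) ^ j * a 0 (Suc j) *
     pf N (\<lambda>x y. a (Suc (insert_index j x)) (Suc (insert_index j y))))"
    by (simp add: pf_def sum_distrib_left flip: sum.cartesian_product)
  finally show ?thesis .
qed

lemma pfaffian_eq_pf: "pfaffian A = pf (dim_row A div 2) (\<lambda>i j. A $$ (i, j))"
  by (simp add: pfaffian_def pf_def matchings_def Let_def)

section \<open>Pfaffians indexed by lists of labels\<close>

definition remove_nth :: "nat \<Rightarrow> 'a list \<Rightarrow> 'a list" where
  "remove_nth j xs = take j xs @ drop (Suc j) xs"

lemma length_remove_nth: "j < length xs \<Longrightarrow> length (remove_nth j xs) = length xs - 1"
  by (simp add: remove_nth_def)

lemma nth_remove_nth: "j < length xs \<Longrightarrow> x < length xs - 1 \<Longrightarrow> remove_nth j xs ! x =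
    xs ! insert_index j x"
  by (auto simp: remove_nth_def nth_append insert_index_def min_def)

lemma remove_nth_simps [simp]:
  "remove_nth 0 (x # xs) = xs"
  "remove_nth (Suc j) (x # xs) = x # remove_nth j xs"
  by (simp_all add: remove_nth_def)

lemma remove_nth_append: "remove_nth j (xs @ ys) =
    (if j < length xs then remove_nth j xs @ ys else xs @ remove_nth (j - length xs) ys)"
  by (auto simp: remove_nth_def Suc_diff_le)

lemma map_remove_nth: "map f (remove_nth j xs) = remove_nth j (map f xs)"
  by (simp add: remove_nth_def take_map drop_map)

lemma sum_list_remove_nth:
  fixes xs :: "'a::ab_group_add list"
  shows "j < length xs \<Longrightarrow> sum_list (remove_nth j xs) = sum_list xs - xs ! j"
  by (induction xs arbitrary: j) (auto simp: nth_Cons' less_Suc_eq_0_disj)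

lemma pf_Suc_list:
  assumes "length (z # zs) = 2 * Suc N"
  shows "pf (Suc N) (\<lambda>i j. c ((z # zs) ! i) ((z # zs) ! j)) =
    (\<Sum>j<length zs. (-1) ^ j * c z (zs ! j) * pf N (\<lambda>x y. c (remove_nth j zs ! x)
        (remove_nth j zs ! y)))"
proof -
  have l: "length zs = 2 * N + 1" using assms by simp
  show ?thesis
    unfolding pf_Suc l
    by (intro sum.cong refl arg_cong2[where f = times] pf_cong) (simp_all add: nth_remove_nth l)
qed

section \<open>Wick's theorem\<close>

definition const_coeff :: "Gam \<Rightarrow> Qt" where
  "const_coeff u = Poly_Mapping.lookup u 0"

lemma const_coeff_simps [simp]:
  "const_coeff 0 = 0" "const_coeff 1 = 1"
  "const_coeff (u + v) = const_coeff u + const_coeff v"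
  "const_coeff (- u) = - const_coeff u"
  "const_coeff (scal c u) = c * const_coeff u"
  "const_coeff (\<Sum>i\<in>I. f i) = (\<Sum>i\<in>I. const_coeff (f i))"
  by (simp_all add: const_coeff_def lookup_add lookup_sum)

text \<open>A product of monomials is constant only if both factors are.\<close>

lemma const_coeff_mult: "const_coeff (u * v) = const_coeff u * const_coeff v"
proof -
  have single: "const_coeff (Poly_Mapping.single m c * Poly_Mapping.single m' c') =
      const_coeff (Poly_Mapping.single m c) * const_coeff (Poly_Mapping.single m' c')" for m m' c c'
  proof (cases "m = 0 \<and> m' = 0")
    case False
    have "m = 0 \<and> m' = 0" if "m + m' = 0"
    proof -
      have "Poly_Mapping.lookup m k + Poly_Mapping.lookup m' k = 0" for k
        using that by (metis lookup_add lookup_zero)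
      then show ?thesis by (auto intro!: poly_mapping_eqI)
    qed
    with False have "m + m' \<noteq> 0" by blast
    then show ?thesis using False by (auto simp: const_coeff_def mult_single lookup_single when_def)
  qed (simp add: const_coeff_def mult_single)
  have left: "const_coeff (u * Poly_Mapping.single m' c') = const_coeff u * const_coeff
      (Poly_Mapping.single m' c')" for u m' c'
    by (induction u rule: Gam_induct) (simp_all add: single distrib_right)
  show ?thesis
    by (induction v rule: Gam_induct) (simp_all add: left distrib_left)
qed

lemma const_coeff_Qz: "k \<noteq> 0 \<Longrightarrow> const_coeff (Qz k) = 0"
proof (cases "k > 0")
  case True
  then obtain n where n: "k = int n" "n > 0" by (metis zero_less_imp_eq_int)
  have pvar_odd: "const_coeff (pvar_odd j) = 0" for j
  proof -
    have "Poly_Mapping.single i (1::nat) \<noteq> 0" for i :: nat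
      by (metis lookup_single_eq lookup_zero zero_neq_one)
    then show ?thesis by (auto simp: pvar_odd_def pvar_def const_coeff_def lookup_single when_def)
  qed
  have "const_coeff (scal (of_nat n) (Qz k)) = const_coeff (\<Sum>j\<le>n. scal 2 (pvar_odd j * Qz (k -
      int j)))"
    using Qz_rec[of k n] by (simp add: n)
  also have "\<dots> = 0" by (simp add: const_coeff_mult pvar_odd)
  finally show ?thesis using n by simp
qed (simp add: Qz_neg)

text \<open>A summand of Q_n u has a constant part only if its factor Q_(n+j).1 does, that is for n
  + j = 0; with n >= 0 this means n = j = 0.\<close>

lemma const_coeff_Q_op:
  assumes "n \<ge> 0"
  shows "const_coeff (Q_op n u) = (if n = 0 then const_coeff u else 0)"
proof -
  obtain J where J: "\<And>j. j > J \<Longrightarrow> Q_diff j u = 0"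
    using Q_diff_bound[of u] by blast
  have "Q_op n u = (\<Sum>j\<le>J. Qz (n + int j) * Q_diff j u)"
    by (rule Q_op_eq) (rule J)
  also have "const_coeff \<dots> = (\<Sum>j\<le>J. if j = 0 then const_coeff (Qz n) * const_coeff u else 0)"
    unfolding const_coeff_simps
    by (rule sum.cong)
        (use assms in \<open>auto simp: const_coeff_mult const_coeff_Qz Q_diff_eq shift_ops_0\<close>)
  finally show ?thesis by (simp add: Qz_0 const_coeff_Qz)
qed

definition Q_word :: "int list \<Rightarrow> Gam \<Rightarrow> Gam" where
  "Q_word ms u = foldr Q_op ms u"

lemma Q_word_simps [simp]:
  "Q_word [] u = u"
  "Q_word (m # ms) u = Q_op m (Q_word ms u)"
  "Q_word (ms @ ms') u = Q_word ms (Q_word ms' u)"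
  by (simp_all add: Q_word_def)

lemma Q_word_linear:
  "Q_word ms 0 = 0"
  "Q_word ms (u + v) = Q_word ms u + Q_word ms v"
  "Q_word ms (scal c u) = scal c (Q_word ms u)"
  "Q_word ms (- u) = - Q_word ms u"
  "Q_word ms (\<Sum>i\<in>I. f i) = (\<Sum>i\<in>I. Q_word ms (f i))"
  by (induction ms) (simp_all add: Q_op_0 Q_op_add Q_op_scal Q_op_minus Q_op_sum)

lemma Q_fun_word: "Q_fun l = Q_word (map int l) 1"
  by (induction l) (simp_all add: Q_fun_def)

lemma Q_fun_simps: "Q_fun [] = 1" "Q_fun (a # l) = Q_op (int a) (Q_fun l)"
  by (simp_all add: Q_fun_def)

lemma Q_op_swap:
  "Q_op m (Q_op n u) = (if m + n = 0 then scal (2 * parity_sign m) u else 0) - Q_op n (Q_op m u)"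
  by (simp only: Q_op_anticommute[symmetric, of m n u]) simp

lemma Q_op_word:
  "Q_op m (Q_word ms u) = (\<Sum>j<length ms. scal ((-1) ^ j * (if m + ms ! j = 0 then 2 *
      parity_sign m else 0)) (Q_word (remove_nth j ms) u))
     + scal ((-1) ^ length ms) (Q_word ms (Q_op m u))"
proof (induction ms)
  case (Cons a ms)
  have "(if m + a = 0 then scal (2 * parity_sign m) x else 0) = scal (if m + a = 0 then 2 *
      parity_sign m else 0) x" for x
    by simp
  then have "Q_op m (Q_word (a # ms) u) = scal (if m + a = 0 then 2 * parity_sign m else 0)
      (Q_word ms u) -
      Q_op a (Q_op m (Q_word ms u))"
    by (simp only: Q_word_simps Q_op_swap[of m a])
  then show ?case
    unfolding Cons
    by (simp add: sum.lessThan_Suc_shift Q_op_add Q_op_sum Q_op_scal scal_minus_left sum_negf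
        del: sum.lessThan_Suc)
qed simp

text \<open>The constant term of \<open>Q\<^sub>m\<^sub>s g\<^sub>K\<^sup>* Q\<^sub>l.1\<close>, with \<open>K\<close> chosen such that the total degree is 0.\<close>

definition vev :: "int list \<Rightarrow> nat list \<Rightarrow> Qt" where
  "vev ms l = (let K = sum_list ms + int (sum_list l) in
     if K < 0 then 0 else const_coeff (Q_word ms (g_adj (nat K) (Q_fun l))))"

lemma vev_Nil: "vev ms [] = (if sum_list ms = 0 then const_coeff (Q_word ms 1) else 0)"
  by (auto simp: vev_def Let_def Q_fun_simps g_adj_one Q_word_linear)

text \<open>Moving g^* past Q_b lowers both indices by complementary amounts. As \<open>vev\<close>
  is 0 when its degree K is negative, the sum may run to any bound N above K, so one N can serve
  several sums.\<close>

lemma vev_Cons: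
  assumes "sum_list ms + int (sum_list (b # l)) \<le> int N"
  shows "vev ms (b # l) = (\<Sum>i\<le>N. ratio_coeff tvar i * vev (ms @ [int b - int i]) l)"
proof (cases "sum_list ms + int (sum_list (b # l)) < 0")
  case True
  then have "vev (ms @ [int b - int i]) l = 0" for i by (simp add: vev_def)
  with True show ?thesis by (simp add: vev_def)
next
  case False
  define K where "K = nat (sum_list ms + int (sum_list (b # l)))"
  have K: "int K = sum_list ms + int b + int (sum_list l)" using False by (simp add: K_def)
  have "vev ms (b # l) = const_coeff (Q_word ms (g_adj K (Q_fun (b # l))))"
    using False by (simp add: vev_def K_def)
  also have "\<dots> = (\<Sum>i\<le>K. ratio_coeff tvar i * const_coeff (Q_word (ms @ [int b - int i]) (g_adj
      (K - i) (Q_fun l))))"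
    by (simp add: Q_fun_simps g_adj_Q_op Q_word_linear)
  also have "\<dots> = (\<Sum>i\<le>K. ratio_coeff tvar i * vev (ms @ [int b - int i]) l)"
  proof (rule sum.cong)
    fix i assume "i \<in> {..K}"
    then have "nat (sum_list (ms @ [int b - int i]) + int (sum_list l)) = K - i"
      "\<not> sum_list (ms @ [int b - int i]) + int (sum_list l) < 0"
      using K by auto
    then show "ratio_coeff tvar i * const_coeff (Q_word (ms @ [int b - int i]) (g_adj (K - i)
        (Q_fun l))) =
        ratio_coeff tvar i * vev (ms @ [int b - int i]) l"
      unfolding vev_def Let_def by (simp only: if_False)
  qed simp
  also have "\<dots> = (\<Sum>i\<le>N. ratio_coeff tvar i * vev (ms @ [int b - int i]) l)"
  proof (rule sum.mono_neutral_left)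
    show "\<forall>i\<in>{..N} - {..K}. ratio_coeff tvar i * vev (ms @ [int b - int i]) l = 0"
      using K by (auto simp: vev_def)
  qed (use assms K in auto)
  finally show ?thesis .
qed

text \<open>The Clifford constant 2 (-1)^a, halved at a = 0 for the reason seen in the base case of
  \<open>vev_wick_left\<close>.\<close>

definition pairing_coeff :: "nat \<Rightarrow> Qt" where
  "pairing_coeff a = (if a = 0 then 1 else 2 * (-1) ^ a)"

lemma ratio_coeff_eq_f_poly: "ratio_coeff tvar i = f_poly (int i)"
  by (simp add: ratio_coeff_def f_poly_def)

lemma sum_ratio_coeff_delta:
  assumes "b \<le> N"
  shows "(\<Sum>i\<le>N. ratio_coeff tvar i * (if int b - int i = int a then x else 0)) = f_poly (int b -
      int a) * x"
proof (cases "a \<le> b")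
  case True
  have "(\<Sum>i\<le>N. ratio_coeff tvar i * (if int b - int i = int a then x else 0)) =
      (\<Sum>i\<le>N. if i = b - a then ratio_coeff tvar i * x else 0)"
    by (rule sum.cong) (use True in auto)
  then show ?thesis using True assms by (simp add: ratio_coeff_eq_f_poly of_nat_diff)
next
  case False
  then have "int b - int i \<noteq> int a" for i by linarith
  with False show ?thesis by (simp add: f_poly_def)
qed

text \<open>Induction on \<open>l\<close>: the first Q_b is pulled in front of g^*, where Q_(-a)
  meets Q_(b-i), and summing against f_i turns this contraction into f_(b-a). Pulling keeps the
  number of operators that Q_0 has to pass, so its parity survives until \<open>l\<close> is
  empty.\<close>

lemma vev_wick_left:
  assumes "a = 0 \<Longrightarrow> odd (length ms + length l)"
  shows "vev (- int a # ms) l =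
    (\<Sum>j<length ms. (-1) ^ j * (if ms ! j = int a then pairing_coeff a else 0) * vev
        (remove_nth j ms) l) +
    (\<Sum>j<length l. (-1) ^ (length ms + j) * (pairing_coeff a * f_poly (int (l ! j) - int a)) *
        vev ms (remove_nth j l))"
  using assms
proof (induction l arbitrary: ms)
  case Nil
  let ?S = "\<lambda>k. \<Sum>j<length ms. (-1) ^ j * (if ms ! j = int a then k else 0) * const_coeff (Q_word
      (remove_nth j ms) 1)"
  have main: "const_coeff (Q_op (- int a) (Q_word ms 1)) = ?S (pairing_coeff a)"
  proof -
    have sg: "2 * parity_sign (- int a) = (if a = 0 then 2 else 1) * pairing_coeff a"
      by (simp add: pairing_coeff_def parity_sign_of_nat)
    have "const_coeff (Q_op (- int a) (Q_word ms 1)) = ?S (2 * parity_sign (- int a)) +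
        (if a = 0 then (-1) ^ length ms * const_coeff (Q_word ms 1) else 0)"
      by (simp add: Q_op_word Q_op_one Qz_0 Qz_neg Q_word_linear mult.assoc)
    also have "?S (2 * parity_sign (- int a)) = (if a = 0 then 2 else 1) * ?S (pairing_coeff a)"
      unfolding sg sum_distrib_left by (intro sum.cong refl) simp
    finally have *: "const_coeff (Q_op (- int a) (Q_word ms 1)) = (if a = 0 then 2 else 1) * ?S
        (pairing_coeff a) +
        (if a = 0 then (-1) ^ length ms * const_coeff (Q_word ms 1) else 0)" .
    show ?thesis
    proof (cases "a = 0")
      case True
      with Nil have "odd (length ms)" by simp
      \<comment> \<open>For a = 0 let c be this constant term and S the sum with
        \<open>pairing_coeff\<close>. Passing an odd word gives c = 2 S - c, because Q_0 on the left
        does not change c; so c = S.\<close>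
      moreover have "const_coeff (Q_op (- int a) (Q_word ms 1)) = const_coeff (Q_word ms 1)"
        using True by (simp add: const_coeff_Q_op)
      ultimately have "2 * const_coeff (Q_op (- int a) (Q_word ms 1)) = 2 * ?S (pairing_coeff a)"
        using * True by (simp add: algebra_simps)
      then show ?thesis by (simp only: mult_cancel_left two_Qt simp_thms)
    qed (use * in simp)
  qed
  have "(\<Sum>j<length ms. (-1) ^ j * (if ms ! j = int a then pairing_coeff a else 0) * vev
      (remove_nth j ms) []) =
      (\<Sum>j<length ms. if sum_list ms = int a then (-1) ^ j * (if ms ! j =
          int a then pairing_coeff a else 0) * const_coeff (Q_word (remove_nth j ms) 1) else 0)"
    by (rule sum.cong) (auto simp: vev_Nil sum_list_remove_nth)
  also have "\<dots> = (if sum_list ms = int a then ?S (pairing_coeff a) else 0)"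
    by simp
  also have "\<dots> = vev (- int a # ms) []"
    using main by (simp add: vev_Nil)
  finally show ?case by simp
next
  case (Cons b l)
  \<comment> \<open>A single bound for all applications of \<open>vev_Cons\<close> and
    \<open>sum_ratio_coeff_delta\<close> in this step.\<close>
  define N where "N = nat \<bar>sum_list ms\<bar> + b + a + sum_list l"
  have remove_nth_le: "sum_list (remove_nth j l) \<le> sum_list l" for j
  proof (induction l arbitrary: j)
    case (Cons x l)
    then show ?case by (cases j) (simp_all add: trans_le_add2)
  qed (simp add: remove_nth_def)
  have right: "(\<Sum>i\<le>N. ratio_coeff tvar i * vev (ms @ [int b - int i]) (remove_nth j l)) = vev ms
      (remove_nth (Suc j) (b # l))" for j
    unfolding remove_nth_simps
    by (rule vev_Cons[symmetric]) (use remove_nth_le[of j] in \<open>simp add: N_def\<close>)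
  let ?\<delta> = "\<lambda>m. if m = int a then pairing_coeff a else 0"
  have "vev (- int a # ms) (b # l) = (\<Sum>i\<le>N. ratio_coeff tvar i * vev (- int a # (ms @ [int b -
      int i])) l)"
    by (subst vev_Cons[of _ _ _ N]) (simp_all add: N_def)
  also have "\<dots> = (\<Sum>i\<le>N. ratio_coeff tvar i * (
      (\<Sum>j<length ms. (-1) ^ j * ?\<delta> (ms ! j) * vev (remove_nth j ms @ [int b - int i]) l) +
      (-1) ^ length ms * ?\<delta> (int b - int i) * vev ms l +
      (\<Sum>j<length l. (-1) ^ (length ms + Suc j) * (pairing_coeff a * f_poly (int (l ! j) -
          int a)) * vev (ms @ [int b - int i]) (remove_nth j l))))"
  proof (rule sum.cong[OF refl])
    fix i
    show "ratio_coeff tvar i * vev (- int a # (ms @ [int b - int i])) l = ratio_coeff tvar i * (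
      (\<Sum>j<length ms. (-1) ^ j * ?\<delta> (ms ! j) * vev (remove_nth j ms @ [int b - int i]) l) +
      (-1) ^ length ms * ?\<delta> (int b - int i) * vev ms l +
      (\<Sum>j<length l. (-1) ^ (length ms + Suc j) * (pairing_coeff a * f_poly (int (l ! j) -
          int a)) * vev (ms @ [int b - int i]) (remove_nth j l)))"
      using Cons.prems by (subst Cons.IH) (simp_all add: remove_nth_append nth_append)
  qed
  also have "\<dots> = (\<Sum>j<length ms. (-1) ^ j * ?\<delta> (ms ! j) * (\<Sum>i\<le>N. ratio_coeff tvar i * vev
      (remove_nth j ms @ [int b - int i]) l)) +
      (-1) ^ length ms * (\<Sum>i\<le>N. ratio_coeff tvar i * ?\<delta> (int b - int i)) * vev ms l +
      (\<Sum>j<length l. (-1) ^ (length ms + Suc j) * (pairing_coeff a * f_poly (int (l ! j) -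
          int a)) * (\<Sum>i\<le>N. ratio_coeff tvar i * vev (ms @ [int b - int i]) (remove_nth j l)))"
    unfolding distrib_left sum.distrib sum_distrib_left sum_distrib_right
    by (subst (1 4) sum.swap) (simp add: mult_ac)
  also have "(\<Sum>i\<le>N. ratio_coeff tvar i * ?\<delta> (int b - int i)) = f_poly (int b - int a) *
      pairing_coeff a"
    by (rule sum_ratio_coeff_delta) (simp add: N_def)
  also have "(\<Sum>j<length ms. (-1) ^ j * ?\<delta> (ms ! j) * (\<Sum>i\<le>N. ratio_coeff tvar i * vev
      (remove_nth j ms @ [int b - int i]) l)) =
      (\<Sum>j<length ms. (-1) ^ j * ?\<delta> (ms ! j) * vev (remove_nth j ms) (b # l))"
  proof (rule sum.cong[OF refl])
    fix j assume "j \<in> {..<length ms}"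
    then have "sum_list (remove_nth j ms) + int (sum_list (b # l)) \<le> int N" if "ms ! j = int a"
      using that by (simp add: N_def sum_list_remove_nth)
    then show "(-1) ^ j * ?\<delta> (ms ! j) * (\<Sum>i\<le>N. ratio_coeff tvar i * vev
        (remove_nth j ms @ [int b - int i]) l) =
      (-1) ^ j * ?\<delta> (ms ! j) * vev (remove_nth j ms) (b # l)"
      by (cases "ms ! j = int a") (simp_all only:
          vev_Cons[of "remove_nth j ms" b l N] if_True if_False mult_zero_left mult_zero_right)
  qed
  also have "(\<Sum>j<length l. (-1) ^ (length ms + Suc j) * (pairing_coeff a * f_poly (int (l ! j) -
      int a)) * (\<Sum>i\<le>N. ratio_coeff tvar i * vev (ms @ [int b - int i]) (remove_nth j l))) =
      (\<Sum>j<length l. (-1) ^ (length ms + Suc j) * (pairing_coeff a * f_poly (int (l ! j) -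
          int a)) * vev ms (remove_nth (Suc j) (b # l)))"
    by (simp only: right)
  finally show ?case
    by (simp add: sum.lessThan_Suc_shift mult_ac add_ac del: sum.lessThan_Suc)
qed

text \<open>In front of g^*, Q_b becomes a sum of f_i Q_(b-i). A positive index has no constant
  term; an index -a <= 0 contracts with the remaining operators, whose odd number admits a = 0.
  Summing f_(b+a) against these contractions produces f_(b,n).\<close>

lemma vev_wick_right:
  assumes "odd (length l)"
  shows "vev [] (b # l) = (\<Sum>j<length l. (-1) ^ j * f_pair b (l ! j) * vev [] (remove_nth j l))"
proof -
  define M where "M = sum_list l"
  have le: "l ! j \<le> M" if "j < length l" for j
    using that by (simp add: M_def elem_le_sum_list)
  have pos: "vev [m] l = 0" if "m > 0" for m
    using that by (simp add: vev_def Let_def const_coeff_Q_op)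
  have neg: "vev [- int a] l = (\<Sum>j<length l. (-1) ^ j * (pairing_coeff a * f_poly (int (l ! j) -
      int a)) * vev [] (remove_nth j l))" for a
    using vev_wick_left[of a "[]" l] assms by simp
  have "vev [] (b # l) = (\<Sum>i\<le>b + M. ratio_coeff tvar i * vev [int b - int i] l)"
    by (subst vev_Cons[of _ _ _ "b + M"]) (simp_all add: M_def)
  also have "\<dots> = (\<Sum>i\<in>{b..b + M}. ratio_coeff tvar i * vev [int b - int i] l)"
    by (rule sum.mono_neutral_right) (auto simp: pos)
  also have "\<dots> = (\<Sum>a\<le>M. ratio_coeff tvar (b + a) * vev [- int a] l)"
    by (rule sum.reindex_bij_witness[of _ "\<lambda>a. b + a" "\<lambda>i. i - b"]) (auto simp: of_nat_diff)
  also have "\<dots> = (\<Sum>j<length l. (-1) ^ j * (\<Sum>a\<le>M. ratio_coeff tvar (b + a) * (pairing_coeff a *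
      f_poly (int (l ! j) - int a))) * vev [] (remove_nth j l))"
    unfolding neg sum_distrib_left sum_distrib_right
    by (subst sum.swap) (simp add: mult_ac)
  also have "\<dots> = (\<Sum>j<length l. (-1) ^ j * f_pair b (l ! j) * vev [] (remove_nth j l))"
  proof (rule sum.cong[OF refl])
    fix j assume "j \<in> {..<length l}"
    define n where "n = l ! j"
    have n: "n \<le> M" using le \<open>j \<in> _\<close> by (simp add: n_def)
    have "(\<Sum>a\<le>M. ratio_coeff tvar (b + a) * (pairing_coeff a * f_poly (int n - int a))) =
        (\<Sum>a\<le>n. ratio_coeff tvar (b + a) * (pairing_coeff a * f_poly (int n - int a)))"
      by (rule sum.mono_neutral_right) (use n in \<open>auto simp: f_poly_def\<close>)
    \<comment> \<open>The term a = 0 carries \<open>pairing_coeff 0 = 1\<close>, so the leading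
      product has no factor 2.\<close>
    also have "\<dots> = f_poly (int b) * f_poly (int n) + (\<Sum>a=1..n. ratio_coeff tvar (b + a) *
        (pairing_coeff a * f_poly (int n - int a)))"
      by (simp add:
          sum.atLeast_Suc_atMost[of 0] pairing_coeff_def ratio_coeff_eq_f_poly flip: atLeast0AtMost)
    also have "(\<Sum>a=1..n. ratio_coeff tvar (b + a) * (pairing_coeff a * f_poly (int n - int a))) =
        2 * (\<Sum>a=1..n. (-1) ^ a * f_poly (int b + int a) * f_poly (int n - int a))"
      unfolding sum_distrib_left by (rule sum.cong)
          (auto simp: pairing_coeff_def ratio_coeff_eq_f_poly)
    \<comment> \<open>For n = 0 the separate clause of \<open>f_pair\<close> agrees, since f_0 = 1
      and the sum is empty.\<close>
    also have "f_poly (int b) * f_poly (int n) + \<dots> = f_pair b n"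
      by (simp add: f_pair_def) (simp add: f_poly_def)
    finally show "(-1) ^ j * (\<Sum>a\<le>M. ratio_coeff tvar (b + a) * (pairing_coeff a * f_poly (int
        (l ! j) - int a))) * vev [] (remove_nth j l) =
        (-1) ^ j * f_pair b (l ! j) * vev [] (remove_nth j l)"
      by (simp only: n_def)
  qed
  finally show ?thesis .
qed

text \<open>\<open>Inl a\<close> stands for \<open>Q\<^bsub>-a\<^esub>\<close>, to the left of \<open>g\<^sup>*\<close>, and \<open>Inr b\<close> for \<open>Q\<^sub>b\<close>, to its right.\<close>

fun contr :: "nat + nat \<Rightarrow> nat + nat \<Rightarrow> Qt" where
  "contr (Inl a) (Inr b) = pairing_coeff a * f_poly (int b - int a)"
| "contr (Inr b) (Inr c) = f_pair b c"
| "contr _ (Inl _) = 0"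

lemma sum_lessThan_add:
  fixes f :: "nat \<Rightarrow> 'a::comm_monoid_add"
  shows "(\<Sum>j<m. f j) + (\<Sum>j<n. f (m + j)) = (\<Sum>j<m + n. f j)"
  by (induction n) (simp_all add: add.assoc[symmetric])

text \<open>Both sides satisfy the same recursion: contracting the first operator is expanding along
  the first row, and removing two operators is removing two labels.\<close>

lemma vev_eq_pf:
  assumes "length as + length l = 2 * N" and "distinct as"
  shows "vev (map (\<lambda>a. - int a) as) l =
    pf N (\<lambda>i j. contr ((map Inl as @ map Inr l) ! i) ((map Inl as @ map Inr l) ! j))"
  using assms
proof (induction N arbitrary: as l)
  case 0
  then show ?case by (simp add: pf_0 vev_Nil)
next
  case (Suc N)
  show ?case
  proof (cases as)
    case Nil
    with Suc.prems obtain b l' where l: "l = b # l'" by (cases l) auto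
    with Suc.prems Nil have odd: "odd (length l')" "length l' = 2 * N + 1" by auto
    have "vev [] (b # l') = (\<Sum>j<length l'. (-1) ^ j * f_pair b (l' ! j) *
        pf N (\<lambda>x y. contr (remove_nth j (map Inr l') ! x) (remove_nth j (map Inr l') ! y)))"
      unfolding vev_wick_right[OF odd(1)]
    proof (intro sum.cong refl arg_cong2[where f = times])
      fix j assume "j \<in> {..<length l'}"
      then show "vev [] (remove_nth j l') = pf N (\<lambda>x y. contr (remove_nth j (map Inr l') ! x)
          (remove_nth j (map Inr l') ! y))"
        using Suc.IH[of "[]" "remove_nth j l'"] odd by (simp add: length_remove_nth map_remove_nth)
    qed
    then show ?thesis
      using odd(2) by (simp add: Nil l pf_Suc_list[of "Inr b" "map Inr l'" N contr, simplified])
  next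
    case (Cons a as')
    let ?zs = "map Inl as' @ map Inr l"
    let ?ms = "map (\<lambda>a. - int a) as'"
    let ?T = "\<lambda>j. (-1) ^ j * contr (Inl a) (?zs ! j) * pf N (\<lambda>x y. contr (remove_nth j ?zs ! x)
        (remove_nth j ?zs ! y))"
    have len: "length as' + length l = 2 * N + 1" using Suc.prems Cons by simp
    \<comment> \<open>For natural numbers -a' = a forces a = a' = 0, which distinctness forbids. So
      the operators to the left of g^* do not contract with one another: this is the zero block of
      the matrix.\<close>
    have nota: "?ms ! j \<noteq> int a" if "j < length as'" for j
    proof -
      have "as' ! j \<noteq> a" using Suc.prems Cons nth_mem[OF that] by auto
      then show ?thesis using that by auto
    qed
    have "vev (map (\<lambda>a. - int a) as) l = vev (- int a # ?ms) l" by (simp add: Cons)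
    also have "\<dots> = (\<Sum>j<length l. (-1) ^ (length as' + j) * (pairing_coeff a * f_poly (int
        (l ! j) - int a)) * vev ?ms (remove_nth j l))"
    proof -
      have "(\<Sum>j<length ?ms. (-1) ^ j * (if ?ms ! j = int a then pairing_coeff a else 0) * vev
          (remove_nth j ?ms) l) = 0"
      proof (intro sum.neutral ballI)
        fix j assume "j \<in> {..<length ?ms}"
        then have "?ms ! j \<noteq> int a" using nota by simp
        then show "(-1) ^ j * (if ?ms ! j = int a then pairing_coeff a else 0) * vev
            (remove_nth j ?ms) l = 0"
          by (simp only: if_False mult_zero_left mult_zero_right)
      qed
      then show ?thesis
        by (subst vev_wick_left) (use len in simp_all)
    qed
    also have "\<dots> = (\<Sum>j<length l. ?T (length as' + j))"
    proof (rule sum.cong[OF refl])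
      fix j assume j: "j \<in> {..<length l}"
      have "vev ?ms (remove_nth j l) = pf N (\<lambda>x y. contr ((map Inl as' @ map Inr
          (remove_nth j l)) ! x) ((map Inl as' @ map Inr (remove_nth j l)) ! y))"
        by (rule Suc.IH) (use j len Suc.prems Cons in \<open>simp_all add: length_remove_nth\<close>)
      then show "(-1) ^ (length as' + j) * (pairing_coeff a * f_poly (int (l ! j) - int a)) *
          vev ?ms (remove_nth j l) = ?T (length as' + j)"
        using j by (simp add: remove_nth_append nth_append map_remove_nth)
    qed
    also have "\<dots> = (\<Sum>j<length as'. ?T j) + (\<Sum>j<length l. ?T (length as' + j))"
    proof -
      have "(\<Sum>j<length as'. ?T j) = 0"
        by (rule sum.neutral) (simp add: nth_append)
      then show ?thesis by simp
    qed
    also have "\<dots> = (\<Sum>j<length ?zs. ?T j)"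
      using sum_lessThan_add[of ?T "length as'" "length l"] by simp
    also have "\<dots> = pf (Suc N) (\<lambda>i j. contr ((Inl a # ?zs) ! i) ((Inl a # ?zs) ! j))"
      by (rule pf_Suc_list[symmetric]) (simp add: len)
    finally show ?thesis by (simp add: Cons)
  qed
qed

section \<open>Expansion in Schur's Q-functions\<close>

definition parts_ge :: "nat list \<Rightarrow> nat \<Rightarrow> nat" where
  "parts_ge \<mu> x = length (filter ((\<le>) x) \<mu>)"

lemma parts_ge_Cons: "parts_ge (a # \<mu>) x = (if x \<le> a then 1 else 0) + parts_ge \<mu> x"
  by (simp add: parts_ge_def)

text \<open>Containment of diagrams is expressed through the conjugate partitions, whose parts are
  \<open>parts_ge \<mu> x\<close>: this form does not depend on the order of the parts.\<close>

definition bounded_strict :: "int \<Rightarrow> (nat \<Rightarrow> nat) \<Rightarrow> nat list set" where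
  "bounded_strict s C = {\<mu>. sorted_wrt (>) \<mu> \<and> (\<forall>x\<in>set \<mu>. x > 0) \<and> int (sum_list \<mu>) = s \<and>
     (\<forall>x\<ge>1. parts_ge \<mu> x \<le> C x)}"

lemma finite_bounded_strict: "finite (bounded_strict s C)"
  by (rule finite_subset[OF _ finite_strict_partitions[of "nat s"]])
    (auto simp: bounded_strict_def strict_partitions_def)

section \<open>Straightening into strict partitions\<close>

definition Q_span :: "nat list set \<Rightarrow> Gam set" where
  "Q_span A = {u. \<exists>c. u = (\<Sum>\<mu>\<in>A. scal (c \<mu>) (Q_fun \<mu>))}"

lemma Q_span_0: "0 \<in> Q_span A"
  unfolding Q_span_def mem_Collect_eq by (rule exI[of _ "\<lambda>_. 0"]) simp

lemma Q_span_add: "u \<in> Q_span A \<Longrightarrow> v \<in> Q_span A \<Longrightarrow> u + v \<in> Q_span A"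
  unfolding Q_span_def mem_Collect_eq
  by (elim exE, rule_tac x = "\<lambda>\<mu>. c \<mu> + ca \<mu>" in exI) (simp add: scal_add_left sum.distrib)

lemma Q_span_scal: "u \<in> Q_span A \<Longrightarrow> scal d u \<in> Q_span A"
  unfolding Q_span_def mem_Collect_eq
  by (elim exE, rule_tac x = "\<lambda>\<mu>. d * c \<mu>" in exI) (simp add: scal_sum_right)

lemma Q_span_minus: "u \<in> Q_span A \<Longrightarrow> - u \<in> Q_span A"
  using Q_span_scal[of u A "-1"] by (simp add: scal_minus_left)

lemma Q_span_sum: "(\<And>i. i \<in> I \<Longrightarrow> f i \<in> Q_span A) \<Longrightarrow> (\<Sum>i\<in>I. f i) \<in> Q_span A"
  by (induction I rule: infinite_finite_induct) (simp_all add: Q_span_0 Q_span_add)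

lemma Q_span_base:
  assumes "finite A" "\<mu> \<in> A"
  shows "Q_fun \<mu> \<in> Q_span A"
proof -
  have "Q_fun \<mu> = (\<Sum>\<nu>\<in>A. if \<nu> = \<mu> then Q_fun \<nu> else 0)" using assms by simp
  also have "\<dots> = (\<Sum>\<nu>\<in>A. scal (if \<nu> = \<mu> then 1 else 0) (Q_fun \<nu>))" by (rule sum.cong) auto
  finally show ?thesis unfolding Q_span_def mem_Collect_eq by (rule exI[of _ "\<lambda>\<nu>. if \<nu> =
      \<mu> then 1 else 0"])
qed

lemma Q_span_Q_op:
  assumes "u \<in> Q_span A" "\<And>\<mu>. \<mu> \<in> A \<Longrightarrow> Q_op m (Q_fun \<mu>) \<in> Q_span B"
  shows "Q_op m u \<in> Q_span B"
proof -
  obtain c where "u = (\<Sum>\<mu>\<in>A. scal (c \<mu>) (Q_fun \<mu>))" using assms(1) by (auto simp: Q_span_def)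
  then show ?thesis
    by (simp add: Q_op_sum Q_op_scal) (intro Q_span_sum Q_span_scal assms(2))
qed

lemma Q_span_mono:
  assumes "u \<in> Q_span A" "A \<subseteq> B" "finite B"
  shows "u \<in> Q_span B"
proof -
  obtain c where u: "u = (\<Sum>\<mu>\<in>A. scal (c \<mu>) (Q_fun \<mu>))" using assms(1) by (auto simp: Q_span_def)
  show ?thesis unfolding u
    by (intro Q_span_sum Q_span_scal Q_span_base) (use assms in auto)
qed

lemma double_zero_Gam: "(x :: Gam) + x = 0 \<Longrightarrow> x = 0"
  using of_nat_mult_cancel_Gam[of 2 x 0] by simp

text \<open>Insertion of Q_m into a decreasing product, with Q_m Q_m = 0 for m > 0. The resulting
  partitions have at most one box more than \<open>\<nu>\<close> in each of the columns 1, ..., m,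
  and none more elsewhere.\<close>

lemma Q_op_Q_fun_span:
  assumes "sorted_wrt (>) \<nu>" "\<forall>x\<in>set \<nu>. x > 0"
  shows "Q_op m (Q_fun \<nu>) \<in> Q_span (bounded_strict (m + int (sum_list \<nu>))
    (\<lambda>x. parts_ge \<nu> x + (if int x \<le> m then 1 else 0)))"
  using assms
proof (induction \<nu>)
  case Nil
  consider "m > 0" | "m = 0" | "m < 0" by linarith
  then show ?case
  proof cases
    case 1
    then have "[nat m] \<in> bounded_strict (m + int (sum_list [])) (\<lambda>x. parts_ge [] x + (if int x \<le>
        m then 1 else 0))"
      by (auto simp: bounded_strict_def parts_ge_def)
    from Q_span_base[OF finite_bounded_strict this] 1 show ?thesis
      by (simp add: Q_fun_simps)
  next
    case 2
    then have "[] \<in> bounded_strict (m + int (sum_list [])) (\<lambda>x. parts_ge [] x + (if int x \<le>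
        m then 1 else 0))"
      by (auto simp: bounded_strict_def parts_ge_def)
    from Q_span_base[OF finite_bounded_strict this] 2 show ?thesis
      by (simp add: Q_fun_simps Q_op_one Qz_0)
  next
    case 3
    then show ?thesis by (simp add: Q_fun_simps Q_op_one Qz_neg Q_span_0)
  qed
next
  case (Cons v \<nu>)
  let ?B = "bounded_strict (m + int (sum_list (v # \<nu>))) (\<lambda>x. parts_ge (v # \<nu>) x + (if int x \<le>
      m then 1 else 0))"
  consider "m > int v" | "m = int v" | "m < int v" by linarith
  then show ?case
  proof cases
    case 1
    then have "nat m # v # \<nu> \<in> ?B"
      using Cons.prems by (auto simp: bounded_strict_def parts_ge_Cons)
    from Q_span_base[OF finite_bounded_strict this] 1 show ?thesis
      by (simp add: Q_fun_simps)
  next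
    case 2
    have "Q_op m (Q_op m (Q_fun \<nu>)) + Q_op m (Q_op m (Q_fun \<nu>)) = 0"
      using Q_op_anticommute[of m m] Cons.prems 2 by simp
    then have "Q_op m (Q_fun (v # \<nu>)) = 0"
      using 2 by (simp add: Q_fun_simps double_zero_Gam)
    then show ?thesis by (simp add: Q_span_0)
  next
    case 3
    have less: "\<forall>x\<in>set \<nu>. x < v" using Cons.prems by simp
    have main: "Q_op (int v) (Q_op m (Q_fun \<nu>)) \<in> Q_span ?B"
    proof (rule Q_span_Q_op[OF Cons.IH])
      fix \<mu> assume \<mu>: "\<mu> \<in> bounded_strict (m + int (sum_list \<nu>)) (\<lambda>x. parts_ge \<nu> x + (if int x \<le>
          m then 1 else 0))"
      \<comment> \<open>No part of \<open>\<nu>\<close> reaches v, and m < v adds no box in column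
        v; hence all parts of \<open>\<mu>\<close> stay below v and \<open>v # \<mu>\<close> is
        strict.\<close>
      have "parts_ge \<nu> v = 0" using less by (auto simp: parts_ge_def filter_empty_conv not_le)
      then have "parts_ge \<mu> v = 0"
        using \<mu> 3 Cons.prems unfolding bounded_strict_def by (auto dest!: spec[of _ v])
      then have "\<forall>x\<in>set \<mu>. x < v" by (auto simp: parts_ge_def filter_empty_conv not_le)
      then have "v # \<mu> \<in> ?B"
        using \<mu> Cons.prems by (auto simp: bounded_strict_def parts_ge_Cons)
      from Q_span_base[OF finite_bounded_strict this]
      show "Q_op (int v) (Q_fun \<mu>) \<in> Q_span ?B" by (simp add: Q_fun_simps)
    qed (use Cons.prems in auto)
    have rest: "(if m + int v = 0 then scal (2 * parity_sign m) (Q_fun \<nu>) else 0) \<in> Q_span ?B"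
    proof (cases "m + int v = 0")
      case True
      then have "\<nu> \<in> ?B" using Cons.prems by (auto simp: bounded_strict_def parts_ge_Cons)
      from Q_span_scal[OF Q_span_base[OF finite_bounded_strict this]] True show ?thesis by simp
    qed (simp add: Q_span_0)
    show ?thesis
      unfolding Q_fun_simps Q_op_swap[of m "int v"]
      using Q_span_add[OF rest Q_span_minus[OF main]] by simp
  qed
qed

text \<open>Q_(a-i) adds boxes only in columns up to a - i, and these are covered by the row of
  length a.\<close>

lemma g_adj_Q_fun_span: "g_adj k (Q_fun l) \<in> Q_span (bounded_strict (int (sum_list l) - int k)
    (parts_ge l))"
proof (induction l arbitrary: k)
  case Nil
  show ?case
  proof (cases "k = 0")
    case True
    then have "[] \<in> bounded_strict (int (sum_list []) - int k) (parts_ge [])"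
      by (simp add: bounded_strict_def)
    from Q_span_base[OF finite_bounded_strict this] True show ?thesis
      by (simp add: Q_fun_simps g_adj_one)
  qed (simp add: Q_fun_simps g_adj_one Q_span_0)
next
  case (Cons a l)
  show ?case
    unfolding Q_fun_simps g_adj_Q_op
  proof (intro Q_span_sum Q_span_scal Q_span_Q_op[OF Cons])
    fix i \<mu>
    assume i: "i \<in> {..k}" and \<mu>: "\<mu> \<in> bounded_strict (int (sum_list l) - int (k - i)) (parts_ge l)"
    then have "Q_op (int a - int i) (Q_fun \<mu>) \<in> Q_span (bounded_strict (int a - int i + int
        (sum_list \<mu>))
        (\<lambda>x. parts_ge \<mu> x + (if int x \<le> int a - int i then 1 else 0)))"
      by (intro Q_op_Q_fun_span) (auto simp: bounded_strict_def)
    moreover have "bounded_strict (int a - int i + int (sum_list \<mu>)) (\<lambda>x. parts_ge \<mu> x +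
        (if int x \<le> int a - int i then 1 else 0))
        \<subseteq> bounded_strict (int (sum_list (a # l)) - int k) (parts_ge (a # l))"
    proof
      fix \<nu> assume \<nu>: "\<nu> \<in> bounded_strict (int a - int i + int (sum_list \<mu>)) (\<lambda>x. parts_ge \<mu> x +
          (if int x \<le> int a - int i then 1 else 0))"
      have "parts_ge \<nu> x \<le> parts_ge (a # l) x" if "x \<ge> 1" for x
      proof -
        have "parts_ge \<nu> x \<le> parts_ge \<mu> x + (if int x \<le> int a - int i then 1 else
            0)" "parts_ge \<mu> x \<le> parts_ge l x"
          using \<nu> \<mu> that by (auto simp: bounded_strict_def)
        then show ?thesis by (auto simp: parts_ge_Cons split: if_splits)
      qed
      then show "\<nu> \<in> bounded_strict (int (sum_list (a # l)) - int k) (parts_ge (a # l))"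
        using \<nu> \<mu> i by (auto simp: bounded_strict_def)
    qed
    ultimately show "Q_op (int a - int i) (Q_fun \<mu>) \<in> Q_span (bounded_strict (int (sum_list
        (a # l)) - int k) (parts_ge (a # l)))"
      using finite_bounded_strict by (rule Q_span_mono)
  qed
qed

text \<open>If x is the part of \<open>\<mu>\<close> at position i, at least i + 1 parts of
  \<open>\<mu>\<close>, hence of \<open>l\<close>, are at least x; as \<open>l\<close> decreases,
  its part at position i is one of them.\<close>

lemma parts_ge_imp_part_le:
  assumes "sorted_wrt (>) \<mu>" "sorted_wrt (>) l" "\<forall>x\<in>set \<mu>. x > 0"
    and parts_ge: "\<And>x. x \<ge> 1 \<Longrightarrow> parts_ge \<mu> x \<le> parts_ge l x"
  shows "part_le \<mu> l"
  unfolding part_le_def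
proof
  fix i
  show "part \<mu> i \<le> part l i"
  proof (cases "i < length \<mu>")
    case True
    define x where "x = \<mu> ! i"
    have x: "x \<ge> 1" using assms(3) True nth_mem[OF True] by (auto simp: x_def Suc_le_eq)
    have "{..i} \<subseteq> {j. j < length \<mu> \<and> x \<le> \<mu> ! j}"
      using True assms(1) by (auto simp: x_def sorted_wrt_iff_nth_less le_less)
    from card_mono[OF _ this] have "Suc i \<le> parts_ge \<mu> x"
      by (simp add: parts_ge_def length_filter_conv_card)
    also have "\<dots> \<le> parts_ge l x" using parts_ge x by blast
    finally have c: "Suc i \<le> card {j. j < length l \<and> x \<le> l ! j}"
      by (simp add: parts_ge_def length_filter_conv_card)
    have "i < length l \<and> x \<le> l ! i"
    proof (rule ccontr)
      assume not: "\<not> (i < length l \<and> x \<le> l ! i)"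
      have "{j. j < length l \<and> x \<le> l ! j} \<subseteq> {..<i}"
      proof
        fix j assume j: "j \<in> {j. j < length l \<and> x \<le> l ! j}"
        show "j \<in> {..<i}"
        proof (rule ccontr)
          assume "j \<notin> {..<i}"
          then have "i \<le> j" by simp
          with j have "l ! j \<le> l ! i" "i < length l"
            using assms(2) by (auto simp: sorted_wrt_iff_nth_less le_less)
          with j not show False by auto
        qed
      qed
      from card_mono[OF _ this] c show False by simp
    qed
    then show ?thesis using True by (simp add: part_def x_def)
  qed (simp add: part_def)
qed

section \<open>Orthogonality of constant terms\<close>

lemma Q_op_word_distinct:
  assumes "\<forall>x\<in>set ms. m + x \<noteq> 0"
  shows "Q_op m (Q_word ms u) = scal ((-1) ^ length ms) (Q_word ms (Q_op m u))"
proof -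
  have "(\<Sum>j<length ms. scal ((-1) ^ j * (if m + ms ! j = 0 then 2 * parity_sign m else 0)) (Q_word
      (remove_nth j ms) u)) = 0"
    using assms by (intro sum.neutral) auto
  then show ?thesis by (simp add: Q_op_word)
qed

lemma Q_word_Q_op_distinct:
  assumes "\<forall>x\<in>set ms. m + x \<noteq> 0"
  shows "Q_word ms (Q_op m u) = scal ((-1) ^ length ms) (Q_op m (Q_word ms u))"
  using Q_op_word_distinct[OF assms] by (simp flip: power_mult_distrib)

text \<open>The reversal lets Q_(-m), for the largest part m of \<open>\<mu>\<close>, act first. Let
  v be the largest part of \<open>\<nu>\<close>. If m > v, Q_(-m) reaches 1 and annihilates it; if m
  = v, it contracts with Q_v and leaves 2 (-1)^m; if m < v, Q_v passes to the far left, where it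
  kills the constant term.\<close>

lemma Q_word_orthogonal:
  assumes "sorted_wrt (>) \<mu>" "\<forall>x\<in>set \<mu>. x > 0" "sorted_wrt (>) \<nu>" "\<forall>x\<in>set \<nu>. x > 0"
  shows "const_coeff (Q_word (map (\<lambda>a. - int a) (rev \<mu>)) (Q_fun \<nu>)) =
    (if \<mu> = \<nu> then 2 ^ length \<mu> * (-1) ^ sum_list \<mu> else 0)"
  using assms
proof (induction \<mu> arbitrary: \<nu>)
  case Nil
  then show ?case by (cases \<nu>) (auto simp: Q_fun_simps const_coeff_Q_op)
next
  case (Cons m \<mu>)
  let ?W = "Q_word (map (\<lambda>a. - int a) (rev \<mu>))"
  have kill: "Q_op (- int m) (Q_fun \<nu>) = 0" if "\<forall>x\<in>set \<nu>. x < m" for \<nu>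
  proof -
    have "Q_op (- int m) (Q_word (map int \<nu>) 1) = scal ((-1) ^ length \<nu>) (Q_word (map int \<nu>) (Q_op
        (- int m) 1))"
      using Q_op_word_distinct[of "map int \<nu>" "- int m" 1] that by auto
    also have "\<dots> = 0" using Cons.prems by (simp add: Q_op_one Qz_neg Q_word_linear)
    finally show ?thesis by (simp add: Q_fun_word)
  qed
  show ?case
  proof (cases \<nu>)
    case Nil
    then show ?thesis by (simp add: kill Q_word_linear)
  next
    case (Cons v \<nu>')
    consider "m > v" | "m = v" | "m < v" by linarith
    then show ?thesis
    proof cases
      case 1
      then have "\<forall>x\<in>set \<nu>. x < m" using Cons Cons.prems by auto
      then show ?thesis using 1 Cons by (simp add: kill Q_word_linear)
    next
      case 2
      have "Q_op (- int m) (Q_fun \<nu>) = scal (2 * (-1) ^ m) (Q_fun \<nu>')"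
        using kill[of \<nu>'] Cons Cons.prems 2
        by (simp add: Q_fun_simps Q_op_swap[of "- int v" "int v"] Q_op_0 parity_sign_of_nat)
      then show ?thesis
        using Cons.IH[of \<nu>'] Cons Cons.prems 2 by (simp add: Q_word_linear power_add)
    next
      case 3
      have "const_coeff (Q_word (map (\<lambda>a. - int a) (rev (m # \<mu>))) (Q_op (int v) (Q_fun \<nu>'))) = 0"
        by (subst Q_word_Q_op_distinct) (use 3 Cons.prems in \<open>auto simp: const_coeff_Q_op\<close>)
      then show ?thesis using 3 Cons by (simp add: Q_fun_simps)
    qed
  qed
qed

text \<open>The rows are labelled by the padded \<open>\<mu>\<close> in reverse, the order of the
  operators to the left of g^*, followed by \<open>l\<close>; with these labels the entries above
  the diagonal are the contractions.\<close>

lemma pfaffian_M_mat: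
  assumes "sorted_wrt (>) \<mu>" "\<forall>x\<in>set \<mu>. x > 0"
  shows "pfaffian (M_mat l \<mu>) = vev (map (\<lambda>a. - int a) (rev (pad l \<mu>))) l"
proof -
  define as where "as = rev (pad l \<mu>)"
  define r where "r = length (pad l \<mu>)"
  define zs where "zs = map Inl as @ map Inr l"
  have len: "length as = r" by (simp add: as_def r_def)
  have "even (r + length l)" by (auto simp: r_def pad_def)
  then obtain N where N: "r + length l = 2 * N" by (elim evenE)
  have "distinct \<mu>" using assms(1) by (auto simp: sorted_wrt_iff_nth_less distinct_conv_nth neq_iff)
  then have dist: "distinct as" using assms(2) by (auto simp: as_def pad_def)
  \<comment> \<open>Only the last padded part can be 0, and reversal puts it in row 0, where the
    exceptional clause of \<open>B_mat\<close> matches \<open>pairing_coeff 0 = 1\<close>.\<close>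
  have nz: "pad l \<mu> ! i \<noteq> 0" if "i < r - 1" for i
  proof -
    have "pad l \<mu> ! i = \<mu> ! i" "i < length \<mu>"
      using that by (auto simp: pad_def r_def nth_append split: if_splits)
    then show ?thesis using assms(2) by auto
  qed
  have dim: "dim_row (M_mat l \<mu>) = 2 * N"
    by (simp add: M_mat_def Let_def D_mat_def r_def[symmetric] N)
  have entry: "M_mat l \<mu> $$ (i, j) = contr (zs ! i) (zs ! j)" if ij: "i < j" "j < 2 * N" for i j
  proof -
    have idx: "M_mat l \<mu> $$ (i, j) = (if i < r then if j < r then 0 else B_mat l (pad l \<mu>) $$
        (i, j - r)
        else D_mat l $$ (i - r, j - r))"
      using ij N by (auto simp: M_mat_def Let_def D_mat_def B_mat_def r_def)
    consider "j < r" | "i < r" "r \<le> j" | "r \<le> i" by linarith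
    then show ?thesis
    proof cases
      case 1
      then show ?thesis using ij idx by (simp add: zs_def nth_append len)
    next
      case 2
      have zi: "zs ! i = Inl (pad l \<mu> ! (r - 1 - i))"
        using 2 by (simp add: zs_def nth_append len) (simp add: as_def r_def rev_nth)
      have zj: "zs ! j = Inr (l ! (j - r))" using 2 ij N by (simp add: zs_def nth_append len)
      have "B_mat l (pad l \<mu>) $$ (i, j - r) = pairing_coeff (pad l \<mu> ! (r - 1 - i)) * f_poly (int
          (l ! (j - r)) - int (pad l \<mu> ! (r - 1 - i)))"
      proof (cases "i = 0")
        case True
        then show ?thesis using 2 ij N by
            (auto simp: B_mat_def Let_def pairing_coeff_def simp flip: r_def)
      next
        case False
        with 2 have "r - 1 - i < r - 1" by linarith
        from nz[OF this] show ?thesis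
          using False 2 ij N by (simp add: B_mat_def Let_def pairing_coeff_def flip: r_def)
      qed
      then show ?thesis using 2 by (simp add: idx zi zj)
    next
      case 3
      with ij have "i - r < j - r" by linarith
      with 3 show ?thesis using ij N idx by (simp add: zs_def nth_append len D_mat_def)
    qed
  qed
  have "pfaffian (M_mat l \<mu>) = pf N (\<lambda>i j. contr (zs ! i) (zs ! j))"
    unfolding pfaffian_eq_pf dim by (simp, rule pf_cong, rule entry)
  also have "\<dots> = vev (map (\<lambda>a. - int a) as) l"
    unfolding zs_def by (rule vev_eq_pf[symmetric]) (use N dist len in auto)
  finally show ?thesis by (simp add: as_def)
qed

lemma vev_pad: "vev (map (\<lambda>a. - int a) (rev (pad l \<mu>))) l = vev (map (\<lambda>a. - int a) (rev \<mu>)) l"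
  by (simp add: pad_def vev_def Let_def const_coeff_Q_op)

theorem theorem3p3:
  fixes k n :: nat and lam :: "nat list"
  assumes "0 < k" and "k \<le> n" and "lam \<in> strict_partitions n"
  shows "g_adj k (Q_fun lam) =
    (\<Sum>\<mu> | \<mu> \<in> strict_partitions (n - k) \<and> part_le \<mu> lam.
       scal ((1 / 2 ^ length \<mu>) * (- 1) ^ (n - k) * pfaffian (M_mat lam \<mu>)) (Q_fun \<mu>))"
proof -
  let ?S = "{\<mu>. \<mu> \<in> strict_partitions (n - k) \<and> part_le \<mu> lam}"
  have lam: "sorted_wrt (>) lam" "sum_list lam = n"
    using assms(3) by (auto simp: strict_partitions_def)
  have fin: "finite ?S" using finite_strict_partitions[of "n - k"] by simp
  have "bounded_strict (int (sum_list lam) - int k) (parts_ge lam) \<subseteq> ?S"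
    using lam assms(2) by
        (auto simp: bounded_strict_def strict_partitions_def intro!: parts_ge_imp_part_le)
  from Q_span_mono[OF g_adj_Q_fun_span this fin]
  obtain c where c: "g_adj k (Q_fun lam) = (\<Sum>\<mu>\<in>?S. scal (c \<mu>) (Q_fun \<mu>))"
    by (auto simp: Q_span_def)
  have "c \<mu> = (1 / 2 ^ length \<mu>) * (- 1) ^ (n - k) * pfaffian (M_mat lam \<mu>)" if \<mu>: "\<mu> \<in> ?S" for \<mu>
  proof -
    let ?ms = "map (\<lambda>a. - int a) (rev \<mu>)"
    have sp: "sorted_wrt (>) \<nu>" "\<forall>x\<in>set \<nu>. x > 0" "sum_list \<nu> = n - k" if "\<nu> \<in> ?S" for \<nu>
      using that by (auto simp: strict_partitions_def)
    have "sum_list (map (\<lambda>a. - int a) (rev \<nu>)) = - int (sum_list \<nu>)" for \<nu>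
      by (induction \<nu>) simp_all
    then have "sum_list ?ms = - int (n - k)"
      using sp(3)[OF \<mu>] by simp
    \<comment> \<open>The degree K in \<open>vev\<close> is thus exactly k, the index of g^* in the
      theorem.\<close>
    then have "sum_list ?ms + int (sum_list lam) = int k"
      using assms(2) lam by (simp add: of_nat_diff)
    then have "pfaffian (M_mat lam \<mu>) = const_coeff (Q_word ?ms (g_adj k (Q_fun lam)))"
      unfolding pfaffian_M_mat[OF sp(1,2)[OF \<mu>]] vev_pad by (simp add: vev_def)
    also have "\<dots> = (\<Sum>\<nu>\<in>?S. c \<nu> * (if \<mu> = \<nu> then 2 ^ length \<mu> * (-1) ^ sum_list \<mu> else 0))"
      unfolding c Q_word_linear const_coeff_simps
      by (intro sum.cong refl arg_cong2[where f = times] Q_word_orthogonal sp \<mu>)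
    also have "\<dots> = (\<Sum>\<nu>\<in>?S. if \<mu> = \<nu> then c \<mu> * (2 ^ length \<mu> * (-1) ^ (n - k)) else 0)"
      by (rule sum.cong) (use sp(3)[OF \<mu>] in auto)
    also have "\<dots> = c \<mu> * (2 ^ length \<mu> * (-1) ^ (n - k))"
      using \<mu> fin by simp
    \<comment> \<open>Solving for the coefficient moves the power of 2 to the denominator; the sign
      is its own inverse.\<close>
    finally show ?thesis by (simp flip: power_mult_distrib)
  qed
  then show ?thesis unfolding c by (intro sum.cong refl) simp
qed

end
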